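(* Assume that one of the following holds: (i) $b,c>0$, $a=d=e=0$ and $\frac{E_1}{\rho_1}=\frac{E_3}{\rho_3}$; (ii) $b,e>0$, $a=c=d=0$, $G_1\neq G_3$ and $\frac{E_1}{\rho_1}=\frac{E_3}{\rho_3}$; (iii) $b,e>0$, $a=c=d=0$, $G_1=G_3$ and $\frac{E_1}{\rho_1}=\frac{E_3}{\rho_3}$. Then the evolution system $U_t=\mathcal AU$, $U(0)=U_0$ on $\mathcal H$ is unstable, i.e. the semigroup $(e^{t\mathcal A})_{t\ge0}$ is not strongly stable: there exists $U_0\in\mathcal H$ such that $\|e^{t\mathcal A}U_0\|_{\mathcal H}$ does not tend to $0$ as $t\to+\infty$.
   Context: Fix $L>0$ and constants $\rho_1,\rho_2,\rho_3,h_1,h_2,h_3,E_1,E_3,I_1,I_3,G_1,G_3>0$; write $\rho h:=\rho_1h_1+\rho_2h_2+\rho_3h_3$ and $EI:=E_1I_1+E_3I_3$ (each treated as a single symbol). Let $a,b,c,d,e\ge 0$ be damping coefficients. All functions are complex valued on $(0,L)$ and $\|\cdot\|$ is the $L^2(0,L)$ norm. Energy space: $\mathcal H=(H_0^1\times L^2)^2\times H_0^2\times L^2\times (H_0^1\times L^2)^2$ (spaces on $(0,L)$), with elements $U=(u^1,v^1,y^1,z^1,\omega,\psi,u^3,v^3,y^3,z^3)$. Put $\tau=-u^1+u^3+h_2\omega_x-\frac{h_1}{2}y^1-\frac{h_3}{2}y^3$. $\mathcal H$ is a Hilbert space with the norm $$\|U\|_{\mathcal H}^2=E_1h_1\|u^1_x\|^2+\rho_1h_1\|v^1\|^2+E_3h_3\|u^3_x\|^2+\rho_3h_3\|v^3\|^2+EI\|\omega_{xx}\|^2+\rho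 h\|\psi\|^2+E_1I_1\|y^1_x\|^2+\rho_1I_1\|z^1\|^2+E_3I_3\|y^3_x\|^2+\rho_3I_3\|z^3\|^2+G_1h_1\|\omega_x+y^1\|^2+\|\tau\|^2+G_3h_3\|\omega_x+y^3\|^2 .$$ Operator: $D(\mathcal A)=[(H^2\cap H_0^1)\times H_0^1]^2\times (H^4\cap H_0^2)\times H_0^2\times[(H^2\cap H_0^1)\times H_0^1]^2$ and $\mathcal AU$ has the ten components, in order: $v^1$; $(\rho_1h_1)^{-1}[E_1h_1u^1_{xx}+\tau-av^1]$; $z^1$; $(\rho_1I_1)^{-1}[E_1I_1y^1_{xx}+\frac{h_1}{2}\tau-G_1h_1(\omega_x+y^1)-bz^1]$; $\psi$; $(\rho h)^{-1}[-EI\omega_{xxxx}+G_1h_1(\omega_x+y^1)_x+G_3h_3(\omega_x+y^3)_x+h_2\tau_x-c\psi]$; $v^3$; $(\rho_3h_3)^{-1}[E_3h_3u^3_{xx}-\tau-dv^3]$; $z^3$; $(\rho_3I_3)^{-1}[E_3I_3y^3_{xx}+\frac{h_3}{2}\tau-G_3h_3(\omega_x+y^3)-ez^3]$. $\mathcal A$ is m-dissipative and generates a $C_0$-semigroup of contractions $(e^{t\mathcal A})_{t\ge0}$ on $\mathcal H$. *)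

theory Defs
  imports "HOL-Analysis.Analysis"
begin

definition square_integrable :: "(real \<Rightarrow> complex) \<Rightarrow> bool" where
  "square_integrable f \<longleftrightarrow>
     f \<in> borel_measurable lborel \<and> integrable lborel (\<lambda>x. (cmod (f x))\<^sup>2)"

lemma square_integrable_add:
  assumes "square_integrable f" "square_integrable g"
  shows "square_integrable (\<lambda>x. f x + g x)"
proof -
  have m: "f \<in> borel_measurable lborel" "g \<in> borel_measurable lborel"
    using assms by (auto simp: square_integrable_def)
  have le: "(cmod (f x + g x))\<^sup>2 \<le> 2 * (cmod (f x))\<^sup>2 + 2 * (cmod (g x))\<^sup>2" for x
  proof -
    have "(cmod (f x + g x))\<^sup>2 \<le> (cmod (f x) + cmod (g x))\<^sup>2"
      by (intro power_mono norm_triangle_ineq norm_ge_zero)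
    also have "\<dots> \<le> 2 * (cmod (f x))\<^sup>2 + 2 * (cmod (g x))\<^sup>2"
      using sum_squares_bound[of "cmod (f x)" "cmod (g x)"]
      by (simp add: power2_sum)
    finally show ?thesis .
  qed
  have "integrable lborel (\<lambda>x. (cmod (f x + g x))\<^sup>2)"
    by (rule Bochner_Integration.integrable_bound
          [of _ "\<lambda>x. 2 * (cmod (f x))\<^sup>2 + 2 * (cmod (g x))\<^sup>2"])
       (use assms m le in \<open>auto simp: square_integrable_def\<close>)
  with m show ?thesis by (simp add: square_integrable_def)
qed

lemma square_integrable_cmult:
  "square_integrable f \<Longrightarrow> square_integrable (\<lambda>x. c * f x)"
  by (auto simp: square_integrable_def norm_mult power_mult_distrib)

lemma square_integrable_uminus:
  "square_integrable f \<Longrightarrow> square_integrable (\<lambda>x. - f x)"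
  by (auto simp: square_integrable_def)

lemma square_integrable_0: "square_integrable (\<lambda>x. 0)"
  by (simp add: square_integrable_def)

definition l2_rel :: "(real \<Rightarrow> complex) \<Rightarrow> (real \<Rightarrow> complex) \<Rightarrow> bool" where
  "l2_rel f g \<longleftrightarrow>
     square_integrable f \<and> square_integrable g \<and> (AE x in lborel. f x = g x)"

quotient_type l2 = "real \<Rightarrow> complex" / partial: l2_rel
  morphisms rep_l2 abs_l2
proof (rule part_equivpI)
  show "\<exists>f. l2_rel f f"
    using square_integrable_0 by (auto simp: l2_rel_def)
  show "symp l2_rel"
    by (rule sympI) (auto simp: l2_rel_def elim: eventually_mono)
  show "transp l2_rel"
    by (rule transpI) (auto simp: l2_rel_def elim: eventually_elim2)
qed

instantiation l2 :: real_vector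
begin

lift_definition zero_l2 :: l2 is "\<lambda>x. 0"
  by (simp add: l2_rel_def square_integrable_0)

lift_definition plus_l2 :: "l2 \<Rightarrow> l2 \<Rightarrow> l2" is "\<lambda>f g x. f x + g x"
  unfolding l2_rel_def by (auto intro: square_integrable_add elim: eventually_elim2)

lift_definition uminus_l2 :: "l2 \<Rightarrow> l2" is "\<lambda>f x. - f x"
  unfolding l2_rel_def by (auto intro: square_integrable_uminus elim: eventually_mono)

definition minus_l2 :: "l2 \<Rightarrow> l2 \<Rightarrow> l2" where
  "minus_l2 f g = f + - g"

lift_definition scaleR_l2 :: "real \<Rightarrow> l2 \<Rightarrow> l2" is "\<lambda>r f x. of_real r * f x"
  unfolding l2_rel_def by (auto intro: square_integrable_cmult elim: eventually_mono)

instance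
proof
  fix f g h :: l2 and r s :: real
  show "f + g + h = f + (g + h)"
    by transfer (auto simp: l2_rel_def add.assoc intro!: square_integrable_add)
  show "f + g = g + f"
    by transfer (auto simp: l2_rel_def add.commute intro!: square_integrable_add)
  show "0 + f = f"
    by transfer (auto simp: l2_rel_def)
  show "- f + f = 0"
    by transfer (auto simp: l2_rel_def square_integrable_0)
  show "f - g = f + - g"
    by (simp add: minus_l2_def)
  show "r *\<^sub>R (f + g) = r *\<^sub>R f + r *\<^sub>R g"
    by transfer (auto simp: l2_rel_def distrib_left
        intro!: square_integrable_add square_integrable_cmult)
  show "(r + s) *\<^sub>R f = r *\<^sub>R f + s *\<^sub>R f"
    by transfer (auto simp: l2_rel_def distrib_right
        intro!: square_integrable_add square_integrable_cmult)
  show "r *\<^sub>R s *\<^sub>R f = (r * s) *\<^sub>R f"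
    by transfer (auto simp: l2_rel_def mult.assoc intro!: square_integrable_cmult)
  show "1 *\<^sub>R f = f"
    by transfer (auto simp: l2_rel_def)
qed

end

lift_definition scaleC_l2 :: "complex \<Rightarrow> l2 \<Rightarrow> l2" is "\<lambda>c f x. c * f x"
  unfolding l2_rel_def by (auto intro: square_integrable_cmult elim: eventually_mono)

lift_definition norm_l2 :: "l2 \<Rightarrow> real" is
  "\<lambda>f. sqrt (\<integral>x. (cmod (f x))\<^sup>2 \<partial>lborel)"
  unfolding l2_rel_def square_integrable_def
  by (auto intro!: integral_cong_AE elim: eventually_mono)

text \<open>The bilinear pairing (no complex conjugation) used for integration by parts.\<close>

lift_definition pairing :: "l2 \<Rightarrow> l2 \<Rightarrow> complex" is
  "\<lambda>f g. \<integral>x. f x * g x \<partial>lborel"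
  unfolding l2_rel_def square_integrable_def
  by (auto intro!: integral_cong_AE elim: eventually_elim2)

text \<open>
  A function on the interval \<open>(0,L)\<close> is represented by its extension by zero to the real
  line, so that \<^const>\<open>norm_l2\<close> restricts to the norm of \<open>L\<^sup>2(0,L)\<close>.
\<close>

lift_definition vanishes_off :: "real set \<Rightarrow> l2 \<Rightarrow> bool" is
  "\<lambda>S f. AE x in lborel. x \<notin> S \<longrightarrow> f x = 0"
proof -
  fix S and f g :: "real \<Rightarrow> complex"
  assume "l2_rel f g"
  then have "AE x in lborel. f x = g x" by (simp add: l2_rel_def)
  then show "(AE x in lborel. x \<notin> S \<longrightarrow> f x = 0) = (AE x in lborel. x \<notin> S \<longrightarrow> g x = 0)"
    by (intro eventually_subst) (auto elim: eventually_mono)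
qed

definition L2 :: "real \<Rightarrow> l2 set" where
  "L2 L = {f. vanishes_off {0<..<L} f}"

primrec Ck :: "nat \<Rightarrow> (real \<Rightarrow> complex) \<Rightarrow> bool" where
  "Ck 0 \<phi> \<longleftrightarrow> continuous_on UNIV \<phi>"
| "Ck (Suc k) \<phi> \<longleftrightarrow>
     (\<exists>\<phi>'. (\<forall>x. (\<phi> has_vector_derivative \<phi>' x) (at x)) \<and> Ck k \<phi>')"

definition Cc :: "nat \<Rightarrow> real \<Rightarrow> (real \<Rightarrow> complex) set" where
  "Cc k L = {\<phi>. Ck k \<phi> \<and> (\<exists>K. compact K \<and> K \<subseteq> {0<..<L} \<and> (\<forall>x. x \<notin> K \<longrightarrow> \<phi> x = 0))}"

text \<open>
  Weak derivatives are tested against \<open>C\<^sub>c\<^sup>1(0,L)\<close>, as in Brezis' textbook; by mollification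
  this is the same as testing against \<open>C\<^sub>c\<^sup>\<infinity>(0,L)\<close>.
\<close>

definition has_weak_derivative :: "real \<Rightarrow> l2 \<Rightarrow> l2 \<Rightarrow> bool" where
  "has_weak_derivative L f g \<longleftrightarrow> f \<in> L2 L \<and> g \<in> L2 L \<and>
     (\<forall>\<phi>\<in>Cc 1 L. pairing f (abs_l2 (\<lambda>x. vector_derivative \<phi> (at x)))
                   = - pairing g (abs_l2 \<phi>))"

definition wderiv :: "real \<Rightarrow> l2 \<Rightarrow> l2" where
  "wderiv L f = (THE g. has_weak_derivative L f g)"

primrec Sob :: "nat \<Rightarrow> real \<Rightarrow> l2 set" where
  "Sob 0 L = L2 L"
| "Sob (Suc k) L = {f. \<exists>g \<in> Sob k L. has_weak_derivative L f g}"

definition sob_norm :: "nat \<Rightarrow> real \<Rightarrow> l2 \<Rightarrow> real" where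
  "sob_norm k L f = sqrt (\<Sum>j\<le>k. (norm_l2 ((wderiv L ^^ j) f))\<^sup>2)"

text \<open>\<open>H\<^sub>0\<^sup>k(0,L)\<close> is the closure of \<open>C\<^sub>c\<^sup>k(0,L)\<close> in \<open>H\<^sup>k(0,L)\<close>.\<close>

definition Sob0 :: "nat \<Rightarrow> real \<Rightarrow> l2 set" where
  "Sob0 k L = {f \<in> Sob k L. \<forall>\<epsilon>>0. \<exists>\<phi>\<in>Cc k L. sob_norm k L (f - abs_l2 \<phi>) < \<epsilon>}"

text \<open>
  The space is a subset \<open>H\<close> of an ambient complex vector space, with complex scalar
  multiplication \<open>sc\<close> and norm \<open>N\<close>; the operators \<open>T t\<close> only matter for \<open>t \<ge> 0\<close> and on \<open>H\<close>.
\<close>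

definition C0_contraction_semigroup ::
  "(complex \<Rightarrow> 'a \<Rightarrow> 'a) \<Rightarrow> 'a set \<Rightarrow> ('a::real_vector \<Rightarrow> real) \<Rightarrow> (real \<Rightarrow> 'a \<Rightarrow> 'a) \<Rightarrow> bool"
where
  "C0_contraction_semigroup sc H N T \<longleftrightarrow>
     (\<forall>t\<ge>0. \<forall>U\<in>H. T t U \<in> H) \<and>
     (\<forall>t\<ge>0. \<forall>U\<in>H. \<forall>V\<in>H. T t (U + V) = T t U + T t V) \<and>
     (\<forall>t\<ge>0. \<forall>U\<in>H. \<forall>c. T t (sc c U) = sc c (T t U)) \<and>
     (\<forall>U\<in>H. T 0 U = U) \<and>
     (\<forall>s\<ge>0. \<forall>t\<ge>0. \<forall>U\<in>H. T (s + t) U = T s (T t U)) \<and>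
     (\<forall>U\<in>H. ((\<lambda>t. N (T t U - U)) \<longlongrightarrow> 0) (at_right 0)) \<and>
     (\<forall>t\<ge>0. \<forall>U\<in>H. N (T t U) \<le> N U)"

definition generator ::
  "'a set \<Rightarrow> ('a::real_vector \<Rightarrow> real) \<Rightarrow> (real \<Rightarrow> 'a \<Rightarrow> 'a) \<Rightarrow> ('a \<times> 'a) set" where
  "generator H N T = {(U, V). U \<in> H \<and> V \<in> H \<and>
     ((\<lambda>t. N ((1 / t) *\<^sub>R (T t U - U) - V)) \<longlongrightarrow> 0) (at_right 0)}"

record beam =
  len :: real
  rho1 :: real  rho2 :: real  rho3 :: real
  h1 :: real  h2 :: real  h3 :: real
  E1 :: real  E3 :: real
  I1 :: real  I3 :: real
  G1 :: real  G3 :: real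
  damp_a :: real  damp_b :: real  damp_c :: real  damp_d :: real  damp_e :: real

definition rho_h :: "beam \<Rightarrow> real" where
  "rho_h B = rho1 B * h1 B + rho2 B * h2 B + rho3 B * h3 B"

definition EI :: "beam \<Rightarrow> real" where
  "EI B = E1 B * I1 B + E3 B * I3 B"

text \<open>A state is \<open>(u\<^sup>1, v\<^sup>1, y\<^sup>1, z\<^sup>1, \<omega>, \<psi>, u\<^sup>3, v\<^sup>3, y\<^sup>3, z\<^sup>3)\<close>.\<close>

type_synonym state = "l2 \<times> l2 \<times> l2 \<times> l2 \<times> l2 \<times> l2 \<times> l2 \<times> l2 \<times> l2 \<times> l2"

definition scaleC_state :: "complex \<Rightarrow> state \<Rightarrow> state" where
  "scaleC_state k = (\<lambda>(u1, v1, y1, z1, w, p, u3, v3, y3, z3).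
     (scaleC_l2 k u1, scaleC_l2 k v1, scaleC_l2 k y1, scaleC_l2 k z1,
      scaleC_l2 k w, scaleC_l2 k p,
      scaleC_l2 k u3, scaleC_l2 k v3, scaleC_l2 k y3, scaleC_l2 k z3))"

definition energy_space :: "beam \<Rightarrow> state set" where
  "energy_space B = (let H01 = Sob0 1 (len B); H02 = Sob0 2 (len B); X = L2 (len B) in
     {(u1, v1, y1, z1, w, p, u3, v3, y3, z3).
        u1 \<in> H01 \<and> v1 \<in> X \<and> y1 \<in> H01 \<and> z1 \<in> X \<and> w \<in> H02 \<and> p \<in> X \<and>
        u3 \<in> H01 \<and> v3 \<in> X \<and> y3 \<in> H01 \<and> z3 \<in> X})"

definition tau :: "beam \<Rightarrow> l2 \<Rightarrow> l2 \<Rightarrow> l2 \<Rightarrow> l2 \<Rightarrow> l2 \<Rightarrow> l2" where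
  "tau B u1 y1 w u3 y3 =
     - u1 + u3 + h2 B *\<^sub>R wderiv (len B) w - (h1 B / 2) *\<^sub>R y1 - (h3 B / 2) *\<^sub>R y3"

definition energy_norm :: "beam \<Rightarrow> state \<Rightarrow> real" where
  "energy_norm B = (\<lambda>(u1, v1, y1, z1, w, p, u3, v3, y3, z3).
     let D = wderiv (len B) in
     sqrt (E1 B * h1 B * (norm_l2 (D u1))\<^sup>2 + rho1 B * h1 B * (norm_l2 v1)\<^sup>2
         + E3 B * h3 B * (norm_l2 (D u3))\<^sup>2 + rho3 B * h3 B * (norm_l2 v3)\<^sup>2
         + EI B * (norm_l2 (D (D w)))\<^sup>2 + rho_h B * (norm_l2 p)\<^sup>2
         + E1 B * I1 B * (norm_l2 (D y1))\<^sup>2 + rho1 B * I1 B * (norm_l2 z1)\<^sup>2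
         + E3 B * I3 B * (norm_l2 (D y3))\<^sup>2 + rho3 B * I3 B * (norm_l2 z3)\<^sup>2
         + G1 B * h1 B * (norm_l2 (D w + y1))\<^sup>2
         + (norm_l2 (tau B u1 y1 w u3 y3))\<^sup>2
         + G3 B * h3 B * (norm_l2 (D w + y3))\<^sup>2))"

definition op_domain :: "beam \<Rightarrow> state set" where
  "op_domain B =
    (let H01 = Sob0 1 (len B); H02 = Sob0 2 (len B); H2 = Sob 2 (len B); H4 = Sob 4 (len B) in
     {(u1, v1, y1, z1, w, p, u3, v3, y3, z3).
        u1 \<in> H2 \<inter> H01 \<and> v1 \<in> H01 \<and> y1 \<in> H2 \<inter> H01 \<and> z1 \<in> H01 \<and>
        w \<in> H4 \<inter> H02 \<and> p \<in> H02 \<and>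
        u3 \<in> H2 \<inter> H01 \<and> v3 \<in> H01 \<and> y3 \<in> H2 \<inter> H01 \<and> z3 \<in> H01})"

definition beam_op :: "beam \<Rightarrow> state \<Rightarrow> state" where
  "beam_op B = (\<lambda>(u1, v1, y1, z1, w, p, u3, v3, y3, z3).
     let D = wderiv (len B); ta = tau B u1 y1 w u3 y3 in
     (v1,
      (1 / (rho1 B * h1 B)) *\<^sub>R ((E1 B * h1 B) *\<^sub>R D (D u1) + ta - damp_a B *\<^sub>R v1),
      z1,
      (1 / (rho1 B * I1 B)) *\<^sub>R ((E1 B * I1 B) *\<^sub>R D (D y1) + (h1 B / 2) *\<^sub>R ta
         - (G1 B * h1 B) *\<^sub>R (D w + y1) - damp_b B *\<^sub>R z1),
      p,
      (1 / rho_h B) *\<^sub>R (- (EI B *\<^sub>R D (D (D (D w))))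
         + (G1 B * h1 B) *\<^sub>R D (D w + y1) + (G3 B * h3 B) *\<^sub>R D (D w + y3)
         + h2 B *\<^sub>R D ta - damp_c B *\<^sub>R p),
      v3,
      (1 / (rho3 B * h3 B)) *\<^sub>R ((E3 B * h3 B) *\<^sub>R D (D u3) - ta - damp_d B *\<^sub>R v3),
      z3,
      (1 / (rho3 B * I3 B)) *\<^sub>R ((E3 B * I3 B) *\<^sub>R D (D y3) + (h3 B / 2) *\<^sub>R ta
         - (G3 B * h3 B) *\<^sub>R (D w + y3) - damp_e B *\<^sub>R z3)))"

text \<open>\<open>T\<close> is the semigroup \<open>(e\<^bsup>tA\<^esup>)\<close>: it is determined by its generator.\<close>

definition generated_semigroup :: "beam \<Rightarrow> (real \<Rightarrow> state \<Rightarrow> state) \<Rightarrow> bool" where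
  "generated_semigroup B T \<longleftrightarrow>
     C0_contraction_semigroup scaleC_state (energy_space B) (energy_norm B) T \<and>
     generator (energy_space B) (energy_norm B) T = {(U, beam_op B U) | U. U \<in> op_domain B}"

end

(* A state with u1 = u3 and y1 = y3 = w = 0 has tau = 0, and since the wave speeds E1/rho1 and
   E3/rho3 agree, u1 = u3 = sin (pi x / L) vibrates freely at the frequency
   l = sqrt (E1/rho1) pi / L: damping acts only on components that vanish. Hence i l is an
   eigenvalue of the operator. If A U = mu U with Re mu <= 0, then T h U - exp (h mu) U = o(h)
   as h decreases to 0; telescoping over n steps of length t/n and using contractivity
   gives T t U = exp (t mu) U. For mu = i l the energy of the solution is therefore constant. *)
theory Submission
  imports Defs
begin

text \<open>The eigenvector is easy to name; the work lies in showing that it belongs to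
  \<open>op_domain\<close> and in evaluating \<open>beam_op\<close> on it. \<open>wderiv\<close> is
  a definite description, so no derivative can be computed before weak derivatives are known to be
  unique, and this rests on the fundamental lemma of the calculus of variations for compactly
  supported C^1 test functions. \<open>Sob0\<close> is a closure: the sine has nonzero slope at both
  ends of the interval and is no test function itself, so its boundary condition must be proved by
  an explicit approximation in the Sobolev norm. Linearity of \<open>wderiv\<close> is established
  only on Sobolev spaces, hence the energy norm is treated as homogeneous and subadditive on
  \<open>energy_space\<close> alone. The semigroup is known only through its generator; the
  telescoping estimate stands in for uniqueness of solutions of the Cauchy problem.\<close>

section \<open>The normed space of square-integrable functions\<close>

text \<open>The quotient is partial, so \<open>abs_l2 F\<close> is meaningful only for square
  integrable \<open>F\<close>; this case rule supplies such a representative together with its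
  integrability.\<close>

lemma l2_cases [case_names abs]:
  obtains F where "f = abs_l2 F" "square_integrable F"
proof -
  have "l2_rel (rep_l2 f) (rep_l2 f)"
    using Quotient3_rep_reflp[OF Quotient3_l2] .
  then show ?thesis
    using that[of "rep_l2 f"] Quotient3_abs_rep[OF Quotient3_l2, of f]
    by (auto simp: l2_rel_def)
qed

lemma l2_rel_refl: "square_integrable F \<Longrightarrow> l2_rel F F"
  by (simp add: l2_rel_def)

lemma abs_l2_eq_iff:
  assumes "square_integrable F" "square_integrable G"
  shows "abs_l2 F = abs_l2 G \<longleftrightarrow> (AE x in lborel. F x = G x)"
  using Quotient3_rel[OF Quotient3_l2, of F G] assms by (auto simp: l2_rel_def)

lemma abs_l2_add:
  "square_integrable F \<Longrightarrow> square_integrable G \<Longrightarrow> abs_l2 F + abs_l2 G = abs_l2 (\<lambda>x. F x + G x)"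
  by (simp add: plus_l2.abs_eq l2_rel_refl)

lemma abs_l2_scaleC: "square_integrable F \<Longrightarrow> scaleC_l2 c (abs_l2 F) = abs_l2 (\<lambda>x. c * F x)"
  by (simp add: scaleC_l2.abs_eq l2_rel_refl)

lemma norm_abs_l2:
  "square_integrable F \<Longrightarrow> norm_l2 (abs_l2 F) = sqrt (\<integral>x. (cmod (F x))\<^sup>2 \<partial>lborel)"
  by (simp add: norm_l2.abs_eq l2_rel_refl)

lemma pairing_abs_l2:
  "square_integrable F \<Longrightarrow> square_integrable G \<Longrightarrow> pairing (abs_l2 F) (abs_l2 G) = (\<integral>x. F x * G x \<partial>lborel)"
  by (simp add: pairing.abs_eq l2_rel_refl)

lemma zero_l2_eq_abs: "0 = abs_l2 (\<lambda>x. 0)"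
  by (simp add: zero_l2_def)

lemma scaleR_l2_eq_scaleC: "r *\<^sub>R (f :: l2) = scaleC_l2 (of_real r) f"
  by (simp add: scaleR_l2_def scaleC_l2_def)

text \<open>The type class covers real scalars only; the module structure over the complex numbers
  provides the algebra for the factors \<open>\<i> * l\<close> and
  \<open>exp (t * \<mu>)\<close>.\<close>

interpretation scaleC_l2: module scaleC_l2
proof
  fix a b :: complex and f g :: l2
  show "scaleC_l2 a (f + g) = scaleC_l2 a f + scaleC_l2 a g"
    by transfer (auto simp: l2_rel_def distrib_left
        intro!: square_integrable_add square_integrable_cmult)
  show "scaleC_l2 (a + b) f = scaleC_l2 a f + scaleC_l2 b f"
    by transfer (auto simp: l2_rel_def distrib_right
        intro!: square_integrable_add square_integrable_cmult)
  show "scaleC_l2 a (scaleC_l2 b f) = scaleC_l2 (a * b) f"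
    by transfer (auto simp: l2_rel_def mult.assoc intro!: square_integrable_cmult)
  show "scaleC_l2 1 f = f"
    by transfer (auto simp: l2_rel_def)
qed

lemma norm_l2_nonneg: "norm_l2 f \<ge> 0"
  by transfer (auto simp: l2_rel_def)

lemma norm_l2_scaleC: "norm_l2 (scaleC_l2 c f) = cmod c * norm_l2 f"
  by (cases f rule: l2_cases)
     (simp add: abs_l2_scaleC norm_abs_l2 square_integrable_cmult norm_mult power_mult_distrib
        real_sqrt_mult)

lemma norm_l2_eq_0_iff: "norm_l2 f = 0 \<longleftrightarrow> f = 0"
proof (cases f rule: l2_cases)
  case (abs F)
  have "integral\<^sup>L lborel (\<lambda>x. (cmod (F x))\<^sup>2) = 0 \<longleftrightarrow> (AE x in lborel. (cmod (F x))\<^sup>2 = 0)"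
    using abs(2) by (intro integral_nonneg_eq_0_iff_AE) (auto simp: square_integrable_def)
  then show ?thesis
    using abs by (simp add: zero_l2_eq_abs norm_abs_l2 abs_l2_eq_iff square_integrable_0)
qed

text \<open>A weighted Young inequality takes the place of Cauchy-Schwarz. Its weights divide by
  both norms, hence the separate case of a zero summand.\<close>

lemma norm_l2_triangle: "norm_l2 (f + g) \<le> norm_l2 f + norm_l2 g"
proof (cases "f = 0 \<or> g = 0")
  case True
  then show ?thesis by (auto simp: norm_l2_nonneg)
next
  case False
  obtain F where F: "f = abs_l2 F" "square_integrable F" by (cases f rule: l2_cases)
  obtain G where G: "g = abs_l2 G" "square_integrable G" by (cases g rule: l2_cases)
  define a b where "a = norm_l2 f" and "b = norm_l2 g"
  have pos: "a > 0" "b > 0"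
    using False norm_l2_eq_0_iff norm_l2_nonneg unfolding a_def b_def
    by (metis less_eq_real_def)+
  have a2: "(\<integral>x. (cmod (F x))\<^sup>2 \<partial>lborel) = a\<^sup>2"
    using F by (simp add: a_def norm_abs_l2)
  have b2: "(\<integral>x. (cmod (G x))\<^sup>2 \<partial>lborel) = b\<^sup>2"
    using G by (simp add: b_def norm_abs_l2)
  \<comment> \<open>The weights \<open>b / a\<close> and \<open>a / b\<close> are the optimal ones:
    integrating the right-hand side gives exactly \<open>(a + b)\<^sup>2\<close>.\<close>
  have young: "(cmod (F x + G x))\<^sup>2 \<le> (1 + b / a) * (cmod (F x))\<^sup>2 + (1 + a / b) * (cmod (G x))\<^sup>2" for x
  proof -
    have "(cmod (F x + G x))\<^sup>2 \<le> (cmod (F x) + cmod (G x))\<^sup>2"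
      by (intro power_mono norm_triangle_ineq norm_ge_zero)
    moreover have "0 \<le> (b * cmod (F x) - a * cmod (G x))\<^sup>2 / (a * b)"
      using pos by simp
    moreover have "(b * cmod (F x) - a * cmod (G x))\<^sup>2 / (a * b)
        = b / a * (cmod (F x))\<^sup>2 + a / b * (cmod (G x))\<^sup>2 - 2 * cmod (F x) * cmod (G x)"
      using pos by (simp add: power2_eq_square field_simps)
    ultimately show ?thesis by (simp add: power2_sum algebra_simps)
  qed
  have FG: "square_integrable (\<lambda>x. F x + G x)"
    using F G by (intro square_integrable_add)
  have "(\<integral>x. (cmod (F x + G x))\<^sup>2 \<partial>lborel)
      \<le> (\<integral>x. (1 + b / a) * (cmod (F x))\<^sup>2 + (1 + a / b) * (cmod (G x))\<^sup>2 \<partial>lborel)"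
    using F G FG young by (intro integral_mono) (auto simp: square_integrable_def)
  also have "\<dots> = (1 + b / a) * a\<^sup>2 + (1 + a / b) * b\<^sup>2"
    using F G by (simp add: square_integrable_def a2 b2)
  also have "\<dots> = (a + b)\<^sup>2"
    using pos by (simp add: power2_eq_square field_simps)
  finally have "norm_l2 (f + g) \<le> sqrt ((a + b)\<^sup>2)"
    using F G FG by (simp add: abs_l2_add norm_abs_l2 del: real_sqrt_abs)
  then show ?thesis using pos by (simp add: a_def b_def)
qed

text \<open>With the class instance, finite products of \<open>l2\<close> carry their Euclidean
  norm, which later gives the triangle inequality of the energy.\<close>

instantiation l2 :: real_normed_vector
begin

definition norm_l2_eq: "norm f = Defs.norm_l2 f"
definition "sgn f = (f::l2) /\<^sub>R norm f"
definition "dist f g = norm (f - g :: l2)"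
definition "(uniformity :: (l2 \<times> l2) filter) = (INF e\<in>{0<..}. principal {(x, y). dist x y < e})"
definition "open U \<longleftrightarrow> (\<forall>x\<in>U. eventually (\<lambda>(x', y). x' = (x::l2) \<longrightarrow> y \<in> U) uniformity)"

instance
proof
  fix f g :: l2 and U :: "l2 set" and r :: real
  show "dist f g = norm (f - g)" by (rule dist_l2_def)
  show "sgn f = f /\<^sub>R norm f" by (rule sgn_l2_def)
  show "uniformity = (INF e\<in>{0<..}. principal {(x, y :: l2). dist x y < e})"
    by (rule uniformity_l2_def)
  show "open U = (\<forall>x\<in>U. \<forall>\<^sub>F (x', y) in uniformity. x' = x \<longrightarrow> y \<in> U)"
    by (rule open_l2_def)
  show "norm f = 0 \<longleftrightarrow> f = 0" by (simp add: norm_l2_eq norm_l2_eq_0_iff)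
  show "norm (f + g) \<le> norm f + norm g" by (simp add: norm_l2_eq norm_l2_triangle)
  show "norm (r *\<^sub>R f) = \<bar>r\<bar> * norm f"
    by (simp add: norm_l2_eq norm_l2_scaleC scaleR_l2_eq_scaleC)
qed

end

lemma norm_l2_eq_norm: "norm_l2 = norm"
  by (simp add: norm_l2_eq fun_eq_iff)

lemma norm_scaleC_l2 [simp]: "norm (scaleC_l2 c f) = cmod c * norm f"
  by (simp add: norm_l2_scaleC flip: norm_l2_eq_norm)

lemma norm_l2_power2_abs:
  "square_integrable F \<Longrightarrow> (norm (abs_l2 F))\<^sup>2 = (\<integral>x. (cmod (F x))\<^sup>2 \<partial>lborel)"
  by (simp add: norm_abs_l2 flip: norm_l2_eq_norm)

section \<open>The bilinear pairing and the subspace of functions supported in the interval\<close>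

lemma square_integrable_mult_integrable:
  assumes "square_integrable F" "square_integrable G"
  shows "integrable lborel (\<lambda>x. F x * G x)"
proof (rule Bochner_Integration.integrable_bound)
  show "integrable lborel (\<lambda>x. (cmod (F x))\<^sup>2 + (cmod (G x))\<^sup>2)"
    using assms by (simp add: square_integrable_def)
  show "(\<lambda>x. F x * G x) \<in> borel_measurable lborel"
    using assms unfolding square_integrable_def by (intro borel_measurable_times) auto
  have "a * b \<le> a\<^sup>2 + b\<^sup>2" if "a \<ge> 0" "b \<ge> 0" for a b :: real
    using sum_squares_bound[of a b] mult_nonneg_nonneg[OF that] by linarith
  then show "AE x in lborel. norm (F x * G x) \<le> norm ((cmod (F x))\<^sup>2 + (cmod (G x))\<^sup>2)"
    by (simp add: norm_mult)
qed

lemma pairing_add_left: "pairing (f + g) h = pairing f h + pairing g h"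
proof -
  obtain F where F: "f = abs_l2 F" "square_integrable F" by (cases f rule: l2_cases)
  obtain G where G: "g = abs_l2 G" "square_integrable G" by (cases g rule: l2_cases)
  obtain H where H: "h = abs_l2 H" "square_integrable H" by (cases h rule: l2_cases)
  show ?thesis
    using F G H by (simp add: abs_l2_add pairing_abs_l2 square_integrable_add distrib_right
        square_integrable_mult_integrable)
qed

lemma pairing_scaleC_left: "pairing (scaleC_l2 c f) h = c * pairing f h"
proof -
  obtain F where F: "f = abs_l2 F" "square_integrable F" by (cases f rule: l2_cases)
  obtain H where H: "h = abs_l2 H" "square_integrable H" by (cases h rule: l2_cases)
  show ?thesis
    using F H by (simp add: abs_l2_scaleC pairing_abs_l2 square_integrable_cmult mult.assoc)
qed

lemma pairing_0_left: "pairing 0 h = 0"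
  using pairing_scaleC_left[of 0 0 h] by simp

lemma vanishes_off_abs_l2:
  "square_integrable F \<Longrightarrow> vanishes_off S (abs_l2 F) \<longleftrightarrow> (AE x in lborel. x \<notin> S \<longrightarrow> F x = 0)"
  by (simp add: vanishes_off.abs_eq l2_rel_refl)

lemma L2_add: "f \<in> L2 L \<Longrightarrow> g \<in> L2 L \<Longrightarrow> f + g \<in> L2 L"
proof -
  assume *: "f \<in> L2 L" "g \<in> L2 L"
  obtain F where F: "f = abs_l2 F" "square_integrable F" by (cases f rule: l2_cases)
  obtain G where G: "g = abs_l2 G" "square_integrable G" by (cases g rule: l2_cases)
  show ?thesis
    using * F G unfolding L2_def
    by (auto simp: abs_l2_add vanishes_off_abs_l2 square_integrable_add elim: eventually_elim2)
qed

lemma L2_scaleC: "f \<in> L2 L \<Longrightarrow> scaleC_l2 c f \<in> L2 L"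
  by (cases f rule: l2_cases)
     (auto simp: L2_def abs_l2_scaleC vanishes_off_abs_l2 square_integrable_cmult elim: eventually_mono)

lemma L2_0: "0 \<in> L2 L"
  by (simp add: L2_def zero_l2_eq_abs vanishes_off_abs_l2 square_integrable_0)

section \<open>Uniqueness of weak derivatives\<close>

text \<open>Since \<open>ennreal\<close> sends negative reals to 0, the densities \<open>g\<close>
  and \<open>- g\<close> are the positive and negative part of \<open>g\<close>. The two measures
  agree and are finite on all half-lines, so they coincide, and so do their densities almost
  everywhere; where the two parts are equal, both vanish.\<close>

lemma real_AE_zero_if_integral_Ioi_zero:
  fixes g :: "real \<Rightarrow> real"
  assumes g: "integrable lborel g" and zero: "\<And>a. (\<integral>x. indicator {a<..} x * g x \<partial>lborel) = 0"
  shows "AE x in lborel. g x = 0"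
proof -
  have [measurable]: "g \<in> borel_measurable lborel" using g by simp
  have pos: "integrable lborel (\<lambda>x. indicator {a<..} x * max 0 (g x))"
    and neg: "integrable lborel (\<lambda>x. indicator {a<..} x * max 0 (- g x))" for a
    by (rule Bochner_Integration.integrable_bound[OF g]; auto simp: indicator_def)+
  have emeasure_eq: "emeasure (density lborel (\<lambda>x. ennreal (h x))) {a<..}
      = ennreal (\<integral>x. indicator {a<..} x * max 0 (h x) \<partial>lborel)"
    if [measurable]: "h \<in> borel_measurable lborel"
      and int: "integrable lborel (\<lambda>x. indicator {a<..} x * max 0 (h x))" for h :: "real \<Rightarrow> real" and a
  proof -
    have "emeasure (density lborel (\<lambda>x. ennreal (h x))) {a<..}
        = (\<integral>\<^sup>+x. ennreal (indicator {a<..} x * max 0 (h x)) \<partial>lborel)"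
      by (subst emeasure_density)
         (auto intro!: nn_integral_cong simp: indicator_def max_def ennreal_neg)
    also have "\<dots> = ennreal (\<integral>x. indicator {a<..} x * max 0 (h x) \<partial>lborel)"
      by (rule nn_integral_eq_integral[OF int]) (auto simp: indicator_def)
    finally show ?thesis .
  qed
  have eq: "(\<integral>x. indicator {a<..} x * max 0 (g x) \<partial>lborel)
      = (\<integral>x. indicator {a<..} x * max 0 (- g x) \<partial>lborel)" for a
  proof -
    have "(\<integral>x. indicator {a<..} x * max 0 (g x) \<partial>lborel)
          - (\<integral>x. indicator {a<..} x * max 0 (- g x) \<partial>lborel)
        = (\<integral>x. indicator {a<..} x * g x \<partial>lborel)"
      by (subst Bochner_Integration.integral_diff[OF pos neg, symmetric])
         (auto intro!: Bochner_Integration.integral_cong simp: indicator_def max_def)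
    then show ?thesis using zero by simp
  qed
  have "density lborel (\<lambda>x. ennreal (g x)) = density lborel (\<lambda>x. ennreal (- g x))"
    by (rule measure_eqI_lessThan)
       (use pos neg in \<open>auto simp: emeasure_eq eq\<close>)
  then have "AE x in lborel. ennreal (g x) = ennreal (- g x)"
    by (intro sigma_finite_measure.density_unique[OF sigma_finite_lborel]) auto
  then show ?thesis
  proof eventually_elim
    case (elim x)
    then show ?case
      using ennreal_eq_0_iff[of "g x"] ennreal_eq_0_iff[of "- g x"] by (cases "g x \<ge> 0") auto
  qed
qed

text \<open>Squaring removes the kink of the positive part. All test functions below owe their C^1
  regularity to this.\<close>

lemma DERIV_max_0_power2:
  "((\<lambda>x. (max 0 x)\<^sup>2) has_real_derivative 2 * max 0 x) (at x)" for x :: real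
proof -
  consider "x > 0" | "x < 0" | "x = 0" by linarith
  then show ?thesis
  proof cases
    case 1
    have "((\<lambda>x. x\<^sup>2) has_real_derivative 2 * max 0 x) (at x)"
      using 1 by (auto intro!: derivative_eq_intros)
    then show ?thesis
      by (rule has_field_derivative_transform_within_open[where S = "{0<..}"]) (use 1 in auto)
  next
    case 2
    have "((\<lambda>x. 0) has_real_derivative 2 * max 0 x) (at x)"
      using 2 by (auto intro!: derivative_eq_intros)
    then show ?thesis
      by (rule has_field_derivative_transform_within_open[where S = "{..<0}"]) (use 2 in auto)
  next
    case 3
    have "((\<lambda>h. (max 0 h)\<^sup>2 / h) \<longlongrightarrow> 0) (at (0::real))"
    proof (rule Lim_null_comparison)
      show "\<forall>\<^sub>F h in at 0. norm ((max 0 h)\<^sup>2 / h) \<le> \<bar>h::real\<bar>"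
        by (intro always_eventually allI) (auto simp: max_def power2_eq_square)
      show "((\<lambda>h::real. \<bar>h\<bar>) \<longlongrightarrow> 0) (at 0)"
        by (rule tendsto_rabs_zero) (rule tendsto_ident_at)
    qed
    then show ?thesis using 3 by (simp add: DERIV_def)
  qed
qed

lemmas DERIV_max_0_power2' = DERIV_chain2[OF DERIV_max_0_power2]

lemma Ck_1_of_real:
  assumes "\<And>x. (f has_real_derivative f' x) (at x)" "continuous_on UNIV f'"
  shows "Ck 1 (\<lambda>x. of_real (f x))"
  unfolding One_nat_def Ck.simps
proof (intro exI conjI allI)
  fix x
  show "((\<lambda>x. complex_of_real (f x)) has_vector_derivative complex_of_real (f' x)) (at x)"
    using assms(1)[of x] by (intro has_vector_derivative_of_real)
  show "continuous_on UNIV (\<lambda>x. complex_of_real (f' x))"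
    using assms(2) by (intro continuous_intros)
qed

text \<open>The test functions \<open>s / (c + s)\<close> with \<open>s = (max 0 (p - c))\<^sup>2\<close>, \<open>p x = (x - a) * (b - x)\<close>
  are continuously differentiable and increase to the indicator of \<open>(a,b)\<close> as \<open>c\<close> decreases to 0.\<close>

definition cutoff :: "real \<Rightarrow> real \<Rightarrow> real \<Rightarrow> real \<Rightarrow> real" where
  "cutoff a b c x = (let s = (max 0 ((x - a) * (b - x) - c))\<^sup>2 in s / (c + s))"

lemma cutoff_nonneg: "c > 0 \<Longrightarrow> 0 \<le> cutoff a b c x"
  and cutoff_le_1: "c > 0 \<Longrightarrow> cutoff a b c x \<le> 1"
  by (simp_all add: cutoff_def Let_def divide_le_eq_1 add_pos_nonneg)

lemma cutoff_in_Cc: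
  assumes "0 \<le> a" "a < b" "b \<le> L" "c > 0"
  shows "(\<lambda>x. of_real (cutoff a b c x)) \<in> Cc 1 L"
proof -
  \<comment> \<open>Off this set the squared positive part is 0. As the quadratic vanishes at
    \<open>a\<close> and \<open>b\<close> while \<open>c > 0\<close>, the set stays inside the open
    interval even for \<open>a = 0\<close> and \<open>b = L\<close>.\<close>
  define K where "K = {a..b} \<inter> {x. c \<le> (x - a) * (b - x)}"
  have "compact K"
    unfolding K_def by (intro compact_Int_closed compact_Icc closed_Collect_le continuous_intros)
  moreover have "K \<subseteq> {0<..<L}"
  proof
    fix x assume x: "x \<in> K"
    then have "x \<noteq> a" "x \<noteq> b" using assms by (auto simp: K_def)
    then show "x \<in> {0<..<L}" using x assms by (auto simp: K_def)
  qed
  moreover have "of_real (cutoff a b c x) = (0::complex)" if "x \<notin> K" for x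
  proof -
    have "(x - a) * (b - x) - c \<le> 0"
    proof (cases "x \<in> {a..b}")
      case True then show ?thesis using that by (auto simp: K_def)
    next
      case False
      then have "(x - a) * (b - x) \<le> 0" using assms by (auto simp: mult_le_0_iff)
      then show ?thesis using assms by simp
    qed
    then show ?thesis by (simp add: cutoff_def max_def)
  qed
  moreover have "Ck 1 (\<lambda>x. of_real (cutoff a b c x))"
  proof (rule Ck_1_of_real)
    let ?p = "\<lambda>x. (x - a) * (b - x) - c"
    let ?s = "\<lambda>x. (max 0 (?p x))\<^sup>2"
    let ?s' = "\<lambda>x. 2 * max 0 (?p x) * (a + b - 2 * x)"
    have pos: "c + ?s x > 0" for x using assms by (simp add: add_pos_nonneg)
    fix x
    have "(?p has_real_derivative (a + b - 2 * x)) (at x)"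
      by (auto intro!: derivative_eq_intros simp: algebra_simps)
    from DERIV_max_0_power2'[OF this]
    have "(?s has_real_derivative ?s' x) (at x)" by simp
    note DERIV_divide[OF this DERIV_add[OF DERIV_const[of c] this]]
    then show "(cutoff a b c has_real_derivative
        (?s' x * (c + ?s x) - ?s x * ?s' x) / ((c + ?s x) * (c + ?s x))) (at x)"
      using pos[of x] by (simp add: cutoff_def[abs_def] Let_def)
    show "continuous_on UNIV (\<lambda>x. (?s' x * (c + ?s x) - ?s x * ?s' x) / ((c + ?s x) * (c + ?s x)))"
      using pos by (intro continuous_intros) (auto simp: less_imp_neq[THEN not_sym])
  qed
  ultimately show ?thesis by (auto simp: Cc_def)
qed

lemma cutoff_tendsto:
  assumes "a < b"
  shows "(\<lambda>n. cutoff a b (inverse (real (Suc n))) x) \<longlonglongrightarrow> indicator {a<..<b} x"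
proof (cases "x \<in> {a<..<b}")
  case True
  define p where "p = (x - a) * (b - x)"
  have p: "p > 0" using True by (simp add: p_def)
  have c: "(\<lambda>n. inverse (real (Suc n))) \<longlonglongrightarrow> 0" by (rule LIMSEQ_inverse_real_of_nat)
  have "(\<lambda>n. (max 0 (p - inverse (real (Suc n))))\<^sup>2 /
        (inverse (real (Suc n)) + (max 0 (p - inverse (real (Suc n))))\<^sup>2))
     \<longlonglongrightarrow> (max 0 (p - 0))\<^sup>2 / (0 + (max 0 (p - 0))\<^sup>2)"
    using p by (intro tendsto_intros c) auto
  also have "(max 0 (p - 0))\<^sup>2 / (0 + (max 0 (p - 0))\<^sup>2) = 1"
    using p by simp
  finally show ?thesis using True by (simp add: cutoff_def Let_def p_def)
next
  case False
  then have "(x - a) * (b - x) \<le> 0" using assms by (auto simp: mult_le_0_iff)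
  moreover have "inverse (real (Suc n)) > 0" for n by simp
  ultimately have "(x - a) * (b - x) - inverse (real (Suc n)) \<le> 0" for n
    by (smt (verit))
  then show ?thesis using False by (simp add: cutoff_def max_absorb1 Let_def del: of_nat_Suc)
qed

text \<open>The fundamental lemma of the calculus of variations: by dominated convergence the
  cutoffs may be replaced by indicators of intervals, so all integrals of \<open>G\<close> over
  half-lines vanish, and real and imaginary part can be treated separately.\<close>

lemma AE_zero_if_orthogonal_to_Cc:
  assumes G: "square_integrable G" and off: "AE x in lborel. x \<notin> {0<..<L} \<longrightarrow> G x = 0"
    and orth: "\<And>\<phi>. \<phi> \<in> Cc 1 L \<Longrightarrow> (\<integral>x. G x * \<phi> x \<partial>lborel) = 0"
  shows "AE x in lborel. G x = 0"
proof -
  have [measurable]: "G \<in> borel_measurable lborel" using G by (simp add: square_integrable_def)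
  \<comment> \<open>Square integrability gives integrability on a bounded interval, through
    \<open>cmod (G x) \<le> 1 + (cmod (G x))\<^sup>2\<close>.\<close>
  have int: "integrable lborel G"
  proof (rule Bochner_Integration.integrable_bound)
    show "integrable lborel (\<lambda>x. indicator {0..L} x + (cmod (G x))\<^sup>2)"
      using G by (intro Bochner_Integration.integrable_add)
        (auto simp: square_integrable_def emeasure_lborel_Icc_eq)
    have "a \<le> 1 + a\<^sup>2" for a :: real
      using sum_squares_bound[of a 1] zero_le_power2[of a] unfolding one_power2 mult_1_right by linarith
    then show "AE x in lborel. norm (G x) \<le> norm (indicat_real {0..L} x + (cmod (G x))\<^sup>2)"
      using off by (auto elim!: eventually_mono simp: indicator_def)
  qed auto
  have interval: "(\<integral>x. indicator {a<..} x *\<^sub>R G x \<partial>lborel) = 0" if "0 \<le> a" "a < L" for a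
  proof -
    let ?c = "\<lambda>n. inverse (real (Suc n))"
    have "(\<lambda>n. \<integral>x. cutoff a L (?c n) x *\<^sub>R G x \<partial>lborel)
        \<longlonglongrightarrow> (\<integral>x. indicator {a<..<L} x *\<^sub>R G x \<partial>lborel)"
    proof (rule integral_dominated_convergence)
      show "integrable lborel (\<lambda>x. norm (G x))" using int by simp
      show "AE x in lborel. (\<lambda>n. cutoff a L (?c n) x *\<^sub>R G x) \<longlonglongrightarrow> indicat_real {a<..<L} x *\<^sub>R G x"
        using that by (intro AE_I2 tendsto_intros cutoff_tendsto)
      show "AE x in lborel. norm (cutoff a L (?c n) x *\<^sub>R G x) \<le> norm (G x)" for n
        using cutoff_nonneg[of "?c n"] cutoff_le_1[of "?c n"]
        by (intro AE_I2) (auto intro!: mult_left_le_one_le)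
      show "(\<lambda>x. cutoff a L (?c n) x *\<^sub>R G x) \<in> borel_measurable lborel" for n
        by (auto simp: cutoff_def Let_def)
    qed auto
    moreover have "(\<integral>x. cutoff a L (?c n) x *\<^sub>R G x \<partial>lborel) = 0" for n
      using orth[OF cutoff_in_Cc, of a L "?c n"] that
      by (simp add: scaleR_conv_of_real mult.commute)
    ultimately have "(\<integral>x. indicator {a<..<L} x *\<^sub>R G x \<partial>lborel) = 0"
      by (simp add: LIMSEQ_const_iff)
    moreover have "(\<integral>x. indicator {a<..} x *\<^sub>R G x \<partial>lborel)
        = (\<integral>x. indicator {a<..<L} x *\<^sub>R G x \<partial>lborel)"
      using off by (intro integral_cong_AE) (auto elim!: eventually_mono simp: indicator_def)
    ultimately show ?thesis by simp
  qed
  \<comment> \<open>\<open>G\<close> vanishes off \<open>{0<..<L}\<close>, so a half-line starting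
    left of 0 may as well start at 0, and one starting at \<open>L\<close> or beyond contributes
    nothing.\<close>
  have Ioi: "(\<integral>x. indicator {a<..} x *\<^sub>R G x \<partial>lborel) = 0" for a
  proof -
    have "(\<integral>x. indicator {a<..} x *\<^sub>R G x \<partial>lborel)
        = (if max a 0 < L then (\<integral>x. indicator {max a 0<..} x *\<^sub>R G x \<partial>lborel) else 0)"
      using off by (auto intro!: integral_cong_AE integral_eq_zero_AE elim!: eventually_mono
          simp: indicator_def)
    then show ?thesis using interval by auto
  qed
  have int': "integrable lborel (\<lambda>x. indicator {a<..} x *\<^sub>R G x)" for a :: real
    using int by (intro integrable_mult_indicator) auto
  have "(\<integral>x. indicator {a<..} x * Re (G x) \<partial>lborel) = Re (\<integral>x. indicator {a<..} x *\<^sub>R G x \<partial>lborel)"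
    "(\<integral>x. indicator {a<..} x * Im (G x) \<partial>lborel) = Im (\<integral>x. indicator {a<..} x *\<^sub>R G x \<partial>lborel)" for a
    using integral_Re[OF int'] integral_Im[OF int'] by simp_all
  then have "AE x in lborel. Re (G x) = 0" "AE x in lborel. Im (G x) = 0"
    using int Ioi by (auto intro!: real_AE_zero_if_integral_Ioi_zero)
  then show ?thesis by eventually_elim (simp add: complex_eq_iff)
qed

text \<open>Classical functions such as the sine stay defined and differentiable on the whole line;
  cutting to the interval happens only on passing to \<open>l2\<close>. Thus the jumps of the zero
  extension never meet a classical derivative.\<close>

definition restrict_l2 :: "real \<Rightarrow> (real \<Rightarrow> complex) \<Rightarrow> l2" where
  "restrict_l2 L f = abs_l2 (\<lambda>x. if x \<in> {0<..<L} then f x else 0)"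

lemma square_integrable_restrict:
  assumes "continuous_on UNIV f"
  shows "square_integrable (\<lambda>x. if x \<in> {0<..<L} then f x else 0)"
proof -
  have [measurable]: "f \<in> borel_measurable borel"
    using assms by (rule borel_measurable_continuous_onI)
  have "integrable lborel (\<lambda>x. indicator {0..L} x *\<^sub>R (cmod (f x))\<^sup>2)"
    using assms by (intro borel_integrable_compact continuous_intros compact_Icc)
      (auto intro: continuous_on_subset)
  then have "integrable lborel (\<lambda>x. (cmod (if x \<in> {0<..<L} then f x else 0))\<^sup>2)"
    by (rule Bochner_Integration.integrable_bound) (auto simp: indicator_def)
  then show ?thesis by (simp add: square_integrable_def)
qed

lemma restrict_l2_in_L2:
  assumes "continuous_on UNIV f"
  shows "restrict_l2 L f \<in> L2 L"
proof -
  have "vanishes_off {0<..<L} (restrict_l2 L f)"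
    unfolding restrict_l2_def vanishes_off_abs_l2[OF square_integrable_restrict[OF assms]]
    by (rule AE_I2) simp
  then show ?thesis by (simp add: L2_def)
qed

lemma restrict_l2_add:
  assumes "continuous_on UNIV f" "continuous_on UNIV g"
  shows "restrict_l2 L f + restrict_l2 L g = restrict_l2 L (\<lambda>x. f x + g x)"
  unfolding restrict_l2_def
  by (subst abs_l2_add) (auto intro!: square_integrable_restrict assms arg_cong[where f = abs_l2] simp del: greaterThanLessThan_iff)

lemma restrict_l2_scaleC:
  assumes "continuous_on UNIV f"
  shows "scaleC_l2 c (restrict_l2 L f) = restrict_l2 L (\<lambda>x. c * f x)"
  unfolding restrict_l2_def
  by (subst abs_l2_scaleC) (auto intro!: square_integrable_restrict assms arg_cong[where f = abs_l2] simp del: greaterThanLessThan_iff)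

lemma restrict_l2_diff:
  assumes "continuous_on UNIV f" "continuous_on UNIV g"
  shows "restrict_l2 L f - restrict_l2 L g = restrict_l2 L (\<lambda>x. f x - g x)"
proof -
  have "restrict_l2 L (\<lambda>x. f x - g x) + restrict_l2 L g = restrict_l2 L f"
    using assms by (subst restrict_l2_add) (auto intro!: continuous_on_diff)
  then show ?thesis by (metis add_diff_cancel_right')
qed

lemma norm_restrict_l2:
  assumes "continuous_on UNIV f"
  shows "(norm (restrict_l2 L f))\<^sup>2 = (\<integral>x. indicator {0<..<L} x * (cmod (f x))\<^sup>2 \<partial>lborel)"
  unfolding restrict_l2_def
  by (subst norm_l2_power2_abs[OF square_integrable_restrict[OF assms]])
     (auto intro!: Bochner_Integration.integral_cong simp: indicator_def)

section \<open>Test functions and classical derivatives\<close>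

lemma has_vector_derivative_imp_continuous_on:
  "(\<And>x. (f has_vector_derivative f' x) (at x)) \<Longrightarrow> continuous_on S f"
  by (meson continuous_at_imp_continuous_on has_vector_derivative_continuous)

lemma Ck_imp_continuous: "Ck k f \<Longrightarrow> continuous_on UNIV f"
  by (cases k) (auto intro: has_vector_derivative_imp_continuous_on)

lemma Cc_abs_l2_eq_restrict: "\<phi> \<in> Cc k L \<Longrightarrow> abs_l2 \<phi> = restrict_l2 L \<phi>"
  unfolding restrict_l2_def by (rule arg_cong[where f = abs_l2]) (auto simp: Cc_def fun_eq_iff)

lemma Cc_square_integrable:
  assumes "\<phi> \<in> Cc k L"
  shows "square_integrable \<phi>"
proof -
  have "square_integrable (\<lambda>x. if x \<in> {0<..<L} then \<phi> x else 0)"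
    using assms by (intro square_integrable_restrict) (auto simp: Cc_def Ck_imp_continuous)
  also have "(\<lambda>x. if x \<in> {0<..<L} then \<phi> x else 0) = \<phi>"
    using assms by (fastforce simp: Cc_def)
  finally show ?thesis .
qed

text \<open>The complement of the compact set is open and the function is zero on it, so the same
  compact set serves for the derivative.\<close>

lemma Cc_deriv:
  assumes "\<phi> \<in> Cc (Suc k) L"
  shows "(\<phi> has_vector_derivative vector_derivative \<phi> (at x)) (at x)"
    and "(\<lambda>x. vector_derivative \<phi> (at x)) \<in> Cc k L"
proof -
  obtain \<phi>' K where *: "\<And>x. (\<phi> has_vector_derivative \<phi>' x) (at x)" "Ck k \<phi>'"
      "compact K" "K \<subseteq> {0<..<L}" "\<And>x. x \<notin> K \<Longrightarrow> \<phi> x = 0"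
    using assms by (auto simp: Cc_def)
  have eq: "(\<lambda>x. vector_derivative \<phi> (at x)) = \<phi>'"
    using vector_derivative_at[OF *(1)] by (rule ext)
  show "(\<phi> has_vector_derivative vector_derivative \<phi> (at x)) (at x)"
    using *(1)[of x] vector_derivative_at[OF *(1)[of x]] by simp
  have "\<phi>' x = 0" if "x \<notin> K" for x
  proof -
    have "((\<lambda>x. 0) has_vector_derivative 0) (at x)" by simp
    then have "(\<phi> has_vector_derivative 0) (at x)"
      by (rule has_vector_derivative_transform_within_open[where S = "- K"])
         (use that * in \<open>auto simp: compact_imp_closed open_Compl\<close>)
    then show ?thesis using *(1) vector_derivative_unique_at by blast
  qed
  then show "(\<lambda>x. vector_derivative \<phi> (at x)) \<in> Cc k L"
    unfolding eq using * by (auto simp: Cc_def)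
qed

text \<open>This is the fundamental theorem of calculus for \<open>f x * \<phi> x\<close> on the
  closed interval. The boundary terms vanish through the test function, so the rule also applies to
  the cosine, which is nonzero at the endpoints.\<close>

lemma has_weak_derivative_restrict:
  assumes "L > 0" and f: "\<And>x. (f has_vector_derivative f' x) (at x)" and f': "continuous_on UNIV f'"
  shows "has_weak_derivative L (restrict_l2 L f) (restrict_l2 L f')"
  unfolding has_weak_derivative_def
proof (intro conjI ballI)
  have cf: "continuous_on UNIV f"
    using f by (rule has_vector_derivative_imp_continuous_on)
  show "restrict_l2 L f \<in> L2 L" "restrict_l2 L f' \<in> L2 L"
    using cf f' by (auto intro: restrict_l2_in_L2)
  fix \<phi> assume \<phi>: "\<phi> \<in> Cc 1 L"
  define \<phi>' where "\<phi>' = (\<lambda>x. vector_derivative \<phi> (at x))"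
  have d\<phi>: "(\<phi> has_vector_derivative \<phi>' x) (at x)" and \<phi>': "\<phi>' \<in> Cc 0 L" for x
    using Cc_deriv[of \<phi> 0 L] \<phi> by (auto simp: \<phi>'_def)
  have zero: "x \<notin> {0<..<L} \<Longrightarrow> \<phi> x = 0" "x \<notin> {0<..<L} \<Longrightarrow> \<phi>' x = 0" for x
    using \<phi> \<phi>' by (auto simp: Cc_def)
  note si = square_integrable_restrict[OF cf, of L] square_integrable_restrict[OF f', of L]
    Cc_square_integrable[OF \<phi>] Cc_square_integrable[OF \<phi>']
  have "pairing (restrict_l2 L f) (abs_l2 \<phi>') + pairing (restrict_l2 L f') (abs_l2 \<phi>)
    = (\<integral>x. (if x \<in> {0<..<L} then f x else 0) * \<phi>' x + (if x \<in> {0<..<L} then f' x else 0) * \<phi> x \<partial>lborel)"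
    unfolding restrict_l2_def
    by (simp only: pairing_abs_l2 si Bochner_Integration.integral_add square_integrable_mult_integrable)
  also have "\<dots> = (\<integral>x. indicator {0..L} x *\<^sub>R (f x * \<phi>' x + f' x * \<phi> x) \<partial>lborel)"
    by (intro Bochner_Integration.integral_cong refl) (use zero in \<open>auto simp: indicator_def\<close>)
  also have "\<dots> = f L * \<phi> L - f 0 * \<phi> 0"
  proof (rule integral_FTC_atLeastAtMost)
    fix x
    show "((\<lambda>x. f x * \<phi> x) has_vector_derivative f x * \<phi>' x + f' x * \<phi> x) (at x within {0..L})"
      by (rule has_vector_derivative_at_within[OF has_vector_derivative_mult[OF f d\<phi>]])
    have "continuous_on UNIV \<phi>" "continuous_on UNIV \<phi>'"
      using has_vector_derivative_imp_continuous_on[OF d\<phi>] \<phi>' by (auto simp: Cc_def)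
    then show "continuous_on {0..L} (\<lambda>x. f x * \<phi>' x + f' x * \<phi> x)"
      using cf f' by (auto intro!: continuous_on_add continuous_on_mult intro: continuous_on_subset)
  qed (use \<open>L > 0\<close> in simp)
  also have "\<dots> = 0" using zero by simp
  finally show "pairing (restrict_l2 L f) (abs_l2 (\<lambda>x. vector_derivative \<phi> (at x)))
      = - pairing (restrict_l2 L f') (abs_l2 \<phi>)"
    by (simp add: \<phi>'_def add_eq_0_iff)
qed

section \<open>Linearity and uniqueness of weak derivatives\<close>

lemma has_weak_derivative_add:
  "has_weak_derivative L f f' \<Longrightarrow> has_weak_derivative L g g' \<Longrightarrow> has_weak_derivative L (f + g) (f' + g')"
  by (auto simp: has_weak_derivative_def L2_add pairing_add_left)

lemma has_weak_derivative_scaleC: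
  "has_weak_derivative L f f' \<Longrightarrow> has_weak_derivative L (scaleC_l2 c f) (scaleC_l2 c f')"
  by (auto simp: has_weak_derivative_def L2_scaleC pairing_scaleC_left)

lemma has_weak_derivative_zero_imp:
  assumes "has_weak_derivative L 0 g"
  shows "g = 0"
proof -
  obtain G where G: "g = abs_l2 G" "square_integrable G" by (cases g rule: l2_cases)
  have "AE x in lborel. G x = 0"
  proof (rule AE_zero_if_orthogonal_to_Cc[OF G(2)])
    show "AE x in lborel. x \<notin> {0<..<L} \<longrightarrow> G x = 0"
      using assms G by (simp add: has_weak_derivative_def L2_def vanishes_off_abs_l2)
    fix \<phi> assume \<phi>: "\<phi> \<in> Cc 1 L"
    have "pairing g (abs_l2 \<phi>) = 0"
      using assms \<phi> by (auto simp: has_weak_derivative_def pairing_0_left)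
    then show "(\<integral>x. G x * \<phi> x \<partial>lborel) = 0"
      using G pairing_abs_l2 Cc_square_integrable[OF \<phi>] by simp
  qed
  then show ?thesis
    using G by (simp add: zero_l2_eq_abs abs_l2_eq_iff square_integrable_0)
qed

lemma has_weak_derivative_unique:
  assumes "has_weak_derivative L f g" "has_weak_derivative L f h"
  shows "g = h"
proof -
  have "has_weak_derivative L (f + scaleC_l2 (-1) f) (g + scaleC_l2 (-1) h)"
    using assms by (intro has_weak_derivative_add has_weak_derivative_scaleC)
  then have "has_weak_derivative L 0 (g - h)"
    by simp
  then show ?thesis using has_weak_derivative_zero_imp by fastforce
qed

text \<open>Uniqueness gives the definite description its value; every later evaluation of
  \<open>wderiv\<close> goes through this rule.\<close>

lemma wderiv_eqI: "has_weak_derivative L f g \<Longrightarrow> wderiv L f = g"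
  unfolding wderiv_def by (blast intro: has_weak_derivative_unique)

section \<open>Sobolev spaces\<close>

lemma SobD:
  assumes "f \<in> Sob (Suc k) L"
  shows "has_weak_derivative L f (wderiv L f)" and "wderiv L f \<in> Sob k L"
  using assms wderiv_eqI by auto

lemma wderiv_add:
  "f \<in> Sob (Suc k) L \<Longrightarrow> g \<in> Sob (Suc k) L \<Longrightarrow> wderiv L (f + g) = wderiv L f + wderiv L g"
  by (intro wderiv_eqI has_weak_derivative_add SobD)

lemma wderiv_scaleC:
  "f \<in> Sob (Suc k) L \<Longrightarrow> wderiv L (scaleC_l2 c f) = scaleC_l2 c (wderiv L f)"
  by (intro wderiv_eqI has_weak_derivative_scaleC SobD)

lemma has_weak_derivative_0: "has_weak_derivative L 0 0"
  by (simp add: has_weak_derivative_def L2_0 pairing_0_left)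

lemma wderiv_0 [simp]: "wderiv L 0 = 0"
  by (intro wderiv_eqI has_weak_derivative_0)

lemma wderiv_restrict:
  assumes "L > 0" "\<And>x. (f has_vector_derivative f' x) (at x)" "continuous_on UNIV f'"
  shows "wderiv L (restrict_l2 L f) = restrict_l2 L f'"
  using assms by (intro wderiv_eqI has_weak_derivative_restrict)

lemma Sob_0: "0 \<in> Sob k L"
  by (induction k) (auto simp: L2_0 intro: has_weak_derivative_0)

lemma Sob_add: "f \<in> Sob k L \<Longrightarrow> g \<in> Sob k L \<Longrightarrow> f + g \<in> Sob k L"
  by (induction k arbitrary: f g) (auto simp: L2_add intro: has_weak_derivative_add)

lemma Sob_scaleC: "f \<in> Sob k L \<Longrightarrow> scaleC_l2 c f \<in> Sob k L"
  by (induction k arbitrary: f) (auto simp: L2_scaleC intro: has_weak_derivative_scaleC)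

lemma l2_diff_eq: "f - g = f + scaleC_l2 (-1) g"
  by simp

lemma Sob_diff: "f \<in> Sob k L \<Longrightarrow> g \<in> Sob k L \<Longrightarrow> f - g \<in> Sob k L"
  unfolding l2_diff_eq by (intro Sob_add Sob_scaleC)

lemma restrict_l2_in_Sob: "L > 0 \<Longrightarrow> Ck k f \<Longrightarrow> restrict_l2 L f \<in> Sob k L"
proof (induction k arbitrary: f)
  case 0
  then show ?case by (simp add: restrict_l2_in_L2)
next
  case (Suc k)
  then obtain f' where "\<And>x. (f has_vector_derivative f' x) (at x)" "Ck k f'" by auto
  then show ?case
    using has_weak_derivative_restrict[OF \<open>L > 0\<close>, of f f'] Suc.IH[of f'] \<open>L > 0\<close>
    by (auto dest: Ck_imp_continuous)
qed

lemma Cc_in_Sob: "L > 0 \<Longrightarrow> \<phi> \<in> Cc k L \<Longrightarrow> abs_l2 \<phi> \<in> Sob k L"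
  by (simp add: Cc_abs_l2_eq_restrict restrict_l2_in_Sob Cc_def)

lemma Ck_add: "Ck k f \<Longrightarrow> Ck k g \<Longrightarrow> Ck k (\<lambda>x. f x + g x)"
proof (induction k arbitrary: f g)
  case (Suc k)
  then obtain f' g' where "\<And>x. (f has_vector_derivative f' x) (at x)" "Ck k f'"
      "\<And>x. (g has_vector_derivative g' x) (at x)" "Ck k g'" by auto
  then show ?case
    using Suc.IH[of f' g'] by (auto intro!: exI[of _ "\<lambda>x. f' x + g' x"] has_vector_derivative_add)
qed (auto intro: continuous_on_add)

lemma Ck_cmult: "Ck k f \<Longrightarrow> Ck k (\<lambda>x. c * f x)"
proof (induction k arbitrary: f)
  case (Suc k)
  then obtain f' where "\<And>x. (f has_vector_derivative f' x) (at x)" "Ck k f'" by auto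
  then show ?case
    using Suc.IH[of f'] by (auto intro!: exI[of _ "\<lambda>x. c * f' x"] has_vector_derivative_mult_right)
qed (auto intro: continuous_on_mult_left)

lemma Cc_add: "\<phi> \<in> Cc k L \<Longrightarrow> \<psi> \<in> Cc k L \<Longrightarrow> (\<lambda>x. \<phi> x + \<psi> x) \<in> Cc k L"
  unfolding Cc_def mem_Collect_eq
proof (elim conjE exE, intro conjI)
  fix K M
  assume "compact K" "K \<subseteq> {0<..<L}" "\<forall>x. x \<notin> K \<longrightarrow> \<phi> x = 0"
    "compact M" "M \<subseteq> {0<..<L}" "\<forall>x. x \<notin> M \<longrightarrow> \<psi> x = 0"
  then show "\<exists>K. compact K \<and> K \<subseteq> {0<..<L} \<and> (\<forall>x. x \<notin> K \<longrightarrow> \<phi> x + \<psi> x = 0)"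
    by (intro exI[of _ "K \<union> M"]) auto
qed (rule Ck_add)

lemma Cc_cmult: "\<phi> \<in> Cc k L \<Longrightarrow> (\<lambda>x. c * \<phi> x) \<in> Cc k L"
  unfolding Cc_def by (auto intro: Ck_cmult)

lemma Ck_0: "Ck k (\<lambda>x. 0)"
  by (induction k) (auto intro!: exI[of _ "\<lambda>x. 0"])

lemma Cc_0: "(\<lambda>x. 0) \<in> Cc k L"
  by (auto simp: Cc_def Ck_0)

text \<open>Additivity of \<open>wderiv\<close> requires that the weak derivatives exist. Each
  application uses up one order of regularity, so the induction on \<open>j\<close> lets
  \<open>k\<close> vary.\<close>

lemma wderiv_funpow_add:
  "f \<in> Sob k L \<Longrightarrow> g \<in> Sob k L \<Longrightarrow> j \<le> k \<Longrightarrow>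
    (wderiv L ^^ j) (f + g) = (wderiv L ^^ j) f + (wderiv L ^^ j) g"
proof (induction j arbitrary: f g k)
  case (Suc j)
  then obtain k' where k: "k = Suc k'" by (cases k) auto
  show ?case
    using Suc.IH[of "wderiv L f" k' "wderiv L g"] Suc.prems
    by (simp add: funpow_Suc_right SobD(2) wderiv_add[of f k' L g] k del: funpow.simps Sob.simps)
qed simp

lemma wderiv_funpow_scaleC:
  "f \<in> Sob k L \<Longrightarrow> j \<le> k \<Longrightarrow> (wderiv L ^^ j) (scaleC_l2 c f) = scaleC_l2 c ((wderiv L ^^ j) f)"
proof (induction j arbitrary: f k)
  case (Suc j)
  then obtain k' where k: "k = Suc k'" by (cases k) auto
  show ?case
    using Suc.IH[of "wderiv L f" k'] Suc.prems
    by (simp add: funpow_Suc_right SobD(2) wderiv_scaleC[of f k' L] k del: funpow.simps Sob.simps)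
qed simp

text \<open>In this form Minkowski's inequality for finite sums yields the triangle inequality of
  the Sobolev norm.\<close>

lemma sob_norm_eq_L2_set: "sob_norm k L f = L2_set (\<lambda>j. norm ((wderiv L ^^ j) f)) {..k}"
  by (simp add: sob_norm_def L2_set_def norm_l2_eq_norm)

lemma sob_norm_triangle:
  assumes "f \<in> Sob k L" "g \<in> Sob k L"
  shows "sob_norm k L (f + g) \<le> sob_norm k L f + sob_norm k L g"
proof -
  have "sob_norm k L (f + g)
      \<le> L2_set (\<lambda>j. norm ((wderiv L ^^ j) f) + norm ((wderiv L ^^ j) g)) {..k}"
    unfolding sob_norm_eq_L2_set using assms
    by (intro L2_set_mono) (auto simp: wderiv_funpow_add norm_triangle_ineq)
  also have "\<dots> \<le> sob_norm k L f + sob_norm k L g"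
    unfolding sob_norm_eq_L2_set by (rule L2_set_triangle_ineq)
  finally show ?thesis .
qed

lemma sob_norm_scaleC:
  assumes "f \<in> Sob k L"
  shows "sob_norm k L (scaleC_l2 c f) = cmod c * sob_norm k L f"
proof -
  have "L2_set (\<lambda>j. norm ((wderiv L ^^ j) (scaleC_l2 c f))) {..k}
      = L2_set (\<lambda>j. cmod c * norm ((wderiv L ^^ j) f)) {..k}"
    using assms by (intro L2_set_cong) (auto simp: wderiv_funpow_scaleC)
  then show ?thesis by (simp add: sob_norm_eq_L2_set L2_set_right_distrib)
qed

section \<open>Closures of the test functions as linear subspaces\<close>

lemma Sob0_imp_Sob: "f \<in> Sob0 k L \<Longrightarrow> f \<in> Sob k L"
  by (simp add: Sob0_def)

lemma Sob0_add:
  assumes "L > 0" "f \<in> Sob0 k L" "g \<in> Sob0 k L"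
  shows "f + g \<in> Sob0 k L"
  unfolding Sob0_def
proof (intro CollectI conjI allI impI)
  have fg: "f \<in> Sob k L" "g \<in> Sob k L" using assms by (auto intro: Sob0_imp_Sob)
  then show "f + g \<in> Sob k L" by (rule Sob_add)
  fix \<epsilon> :: real assume "\<epsilon> > 0"
  then obtain \<phi> \<psi> where \<phi>: "\<phi> \<in> Cc k L" "sob_norm k L (f - abs_l2 \<phi>) < \<epsilon> / 2"
    and \<psi>: "\<psi> \<in> Cc k L" "sob_norm k L (g - abs_l2 \<psi>) < \<epsilon> / 2"
    using assms by (auto simp: Sob0_def dest!: spec[of _ "\<epsilon> / 2"])
  have eq: "f + g - abs_l2 (\<lambda>x. \<phi> x + \<psi> x) = (f - abs_l2 \<phi>) + (g - abs_l2 \<psi>)"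
    using abs_l2_add[OF Cc_square_integrable[OF \<phi>(1)] Cc_square_integrable[OF \<psi>(1)]]
    by (simp add: algebra_simps)
  have "sob_norm k L (f + g - abs_l2 (\<lambda>x. \<phi> x + \<psi> x)) < \<epsilon>"
    using sob_norm_triangle[of "f - abs_l2 \<phi>" k L "g - abs_l2 \<psi>"] \<phi> \<psi> fg assms(1)
    unfolding eq by (simp add: Sob_diff Cc_in_Sob)
  then show "\<exists>\<phi>\<in>Cc k L. sob_norm k L (f + g - abs_l2 \<phi>) < \<epsilon>"
    using Cc_add[OF \<phi>(1) \<psi>(1)] by blast
qed

lemma Sob0_scaleC:
  assumes "L > 0" "f \<in> Sob0 k L"
  shows "scaleC_l2 c f \<in> Sob0 k L"
  unfolding Sob0_def
proof (intro CollectI conjI allI impI)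
  have f: "f \<in> Sob k L" using assms by (auto intro: Sob0_imp_Sob)
  then show "scaleC_l2 c f \<in> Sob k L" by (rule Sob_scaleC)
  fix \<epsilon> :: real assume "\<epsilon> > 0"
  \<comment> \<open>The added 1 keeps the quotient meaningful for \<open>c = 0\<close>.\<close>
  then have "\<epsilon> / (cmod c + 1) > 0" by (simp add: add_nonneg_pos)
  then obtain \<phi> where \<phi>: "\<phi> \<in> Cc k L" "sob_norm k L (f - abs_l2 \<phi>) < \<epsilon> / (cmod c + 1)"
    using assms by (auto simp: Sob0_def)
  have "scaleC_l2 c f - abs_l2 (\<lambda>x. c * \<phi> x) = scaleC_l2 c (f - abs_l2 \<phi>)"
    using abs_l2_scaleC[OF Cc_square_integrable[OF \<phi>(1)], of c]
    by (simp add: scaleC_l2.scale_right_diff_distrib)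
  then have "sob_norm k L (scaleC_l2 c f - abs_l2 (\<lambda>x. c * \<phi> x)) = cmod c * sob_norm k L (f - abs_l2 \<phi>)"
    using \<phi> f assms(1) by (simp add: Sob_diff Cc_in_Sob sob_norm_scaleC)
  also have "\<dots> \<le> cmod c * (\<epsilon> / (cmod c + 1))"
    using \<phi>(2) by (intro mult_left_mono) auto
  also have "\<dots> < \<epsilon>"
    using \<open>\<epsilon> > 0\<close> add_nonneg_pos[OF norm_ge_zero[of c] zero_less_one]
    by (simp add: pos_divide_less_eq algebra_simps)
  finally show "\<exists>\<phi>\<in>Cc k L. sob_norm k L (scaleC_l2 c f - abs_l2 \<phi>) < \<epsilon>"
    using Cc_cmult[OF \<phi>(1)] by blast
qed

lemma Sob0_0: "0 \<in> Sob0 k L"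
proof -
  have "(wderiv L ^^ j) 0 = 0" for j by (induction j) auto
  then have "sob_norm k L (0 - abs_l2 (\<lambda>x. 0)) = 0"
    by (simp add: sob_norm_eq_L2_set L2_set_def flip: zero_l2_eq_abs)
  then show ?thesis
    unfolding Sob0_def using Cc_0[of k L] Sob_0[of k L] by (auto intro!: bexI[of _ "\<lambda>x. 0"])
qed

text \<open>With \<open>m = max 0 (s - c)\<close> the functions \<open>m\<^sup>2 / s\<close>, extended by zero, are test functions which
  converge to \<open>s\<close> as \<open>c\<close> decreases to 0, together with their first derivatives.\<close>

lemma truncation_in_Cc:
  fixes s s' :: "real \<Rightarrow> real"
  assumes s: "\<And>x. (s has_real_derivative s' x) (at x)" and s': "continuous_on UNIV s'"
    and pos: "\<And>x. 0 < x \<Longrightarrow> x < L \<Longrightarrow> 0 < s x" and bdry: "s 0 = 0" "s L = 0" and "c > 0"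
  defines "\<phi> \<equiv> \<lambda>x. if x \<in> {0<..<L} then (max 0 (s x - c))\<^sup>2 / s x else 0"
    and "\<phi>' \<equiv> \<lambda>x. if x \<in> {0<..<L} then s' x * (1 - (1 - max 0 (s x - c) / s x)\<^sup>2) else 0"
  shows "(\<phi> has_real_derivative \<phi>' x) (at x)" and "continuous_on UNIV \<phi>'"
    and "(\<lambda>x. of_real (\<phi> x)) \<in> Cc 1 L"
proof -
  define K where "K = {0..L} \<inter> {x. c \<le> s x}"
  have cs: "continuous_on UNIV s"
    using s by (auto intro!: continuous_at_imp_continuous_on DERIV_isCont)
  have K: "compact K"
    unfolding K_def by (intro compact_Int_closed compact_Icc closed_Collect_le continuous_intros cs)
  have K_sub: "K \<subseteq> {0<..<L}"
  proof
    fix x assume x: "x \<in> K"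
    then have "x \<noteq> 0" "x \<noteq> L" using bdry \<open>c > 0\<close> by (auto simp: K_def)
    then show "x \<in> {0<..<L}" using x by (auto simp: K_def)
  qed
  have open_K: "open (- K)" using K compact_imp_closed by blast
  have off: "max 0 (s x - c) = 0 \<or> x \<notin> {0<..<L}" if "x \<notin> K" for x
    using that by (auto simp: K_def)
  have zero: "\<phi> x = 0" "\<phi>' x = 0" if "x \<notin> K" for x
    using off[OF that] by (auto simp: \<phi>_def \<phi>'_def)
  \<comment> \<open>Two overlapping open sets: on the interval \<open>s\<close> is positive and the
    quotient formula applies, off \<open>K\<close> the function is identically 0. This settles the
    endpoints, where the quotient alone would read 0/0.\<close>
  have cover: "{0<..<L} \<union> - K = UNIV" using K_sub by auto
  show D: "(\<phi> has_real_derivative \<phi>' x) (at x)" for x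
  proof (cases "x \<in> K")
    case True
    then have x: "x \<in> {0<..<L}" using K_sub by auto
    then have sx: "s x > 0" using pos by simp
    have "((\<lambda>x. s x - c) has_real_derivative s' x) (at x)"
      using s by (auto intro!: derivative_eq_intros)
    from DERIV_divide[OF DERIV_max_0_power2'[OF this] s]
    have "((\<lambda>x. (max 0 (s x - c))\<^sup>2 / s x) has_real_derivative
        (2 * max 0 (s x - c) * s' x * s x - (max 0 (s x - c))\<^sup>2 * s' x) / (s x * s x)) (at x)"
      using sx by simp
    \<comment> \<open>Completing the square puts the derivative in a form that exhibits the error
      \<open>s' - \<phi>'\<close> as \<open>s'\<close> times a square.\<close>
    also have "(2 * max 0 (s x - c) * s' x * s x - (max 0 (s x - c))\<^sup>2 * s' x) / (s x * s x) = \<phi>' x"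
    proof -
      have "(2 * m * d * t - m\<^sup>2 * d) / (t * t) = d * (1 - (1 - m / t)\<^sup>2)" if "t > 0" for m d t :: real
        using that by (simp add: field_simps power2_eq_square)
      then show ?thesis using sx x by (simp add: \<phi>'_def)
    qed
    finally show ?thesis
      by (rule has_field_derivative_transform_within_open[where S = "{0<..<L}"])
         (use x in \<open>auto simp: \<phi>_def\<close>)
  next
    case False
    have "((\<lambda>x. 0) has_real_derivative \<phi>' x) (at x)" using zero(2)[OF False] by simp
    then show ?thesis
      by (rule has_field_derivative_transform_within_open[where S = "- K"])
         (use False open_K zero in auto)
  qed
  have "continuous_on ({0<..<L} \<union> - K) \<phi>'"
  proof (rule continuous_on_open_Un[OF open_greaterThanLessThan open_K])
    have "continuous_on {0<..<L} (\<lambda>x. s' x * (1 - (1 - max 0 (s x - c) / s x)\<^sup>2))"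
      using pos by (intro continuous_intros continuous_on_subset[OF cs] continuous_on_subset[OF s'])
        (auto simp: less_imp_neq[THEN not_sym])
    then show "continuous_on {0<..<L} \<phi>'"
      by (rule continuous_on_eq) (simp add: \<phi>'_def)
    show "continuous_on (- K) \<phi>'"
      by (rule continuous_on_eq[OF continuous_on_const[of _ 0]]) (simp add: zero)
  qed
  then show cont: "continuous_on UNIV \<phi>'" by (simp only: cover)
  have "Ck 1 (\<lambda>x. of_real (\<phi> x))" using D cont by (rule Ck_1_of_real)
  then show "(\<lambda>x. of_real (\<phi> x)) \<in> Cc 1 L"
    using K K_sub zero(1) by (auto simp: Cc_def)
qed

text \<open>The truncations at level \<open>1 / (n + 1)\<close> converge in the Sobolev norm: the
  squared error is the sum of two integrals, one for the function and one for the derivative, and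
  dominated convergence applies to each.\<close>

lemma restrict_in_Sob0_1:
  fixes s s' :: "real \<Rightarrow> real"
  assumes "L > 0" and s: "\<And>x. (s has_real_derivative s' x) (at x)" and s': "continuous_on UNIV s'"
    and pos: "\<And>x. 0 < x \<Longrightarrow> x < L \<Longrightarrow> 0 < s x" and bdry: "s 0 = 0" "s L = 0"
  shows "restrict_l2 L (\<lambda>x. of_real (s x)) \<in> Sob0 1 L"
  unfolding Sob0_def
proof (intro CollectI conjI allI impI)
  show "restrict_l2 L (\<lambda>x. of_real (s x)) \<in> Sob 1 L"
    using \<open>L > 0\<close> s s' by (intro restrict_l2_in_Sob Ck_1_of_real)
  define m where "m n x = max 0 (s x - inverse (real (Suc n)))" for n x
  define \<phi> where "\<phi> n x = (if x \<in> {0<..<L} then (m n x)\<^sup>2 / s x else 0)" for n x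
  define \<phi>' where "\<phi>' n x = (if x \<in> {0<..<L} then s' x * (1 - (1 - m n x / s x)\<^sup>2) else 0)" for n x
  have D: "(\<phi> n has_real_derivative \<phi>' n x) (at x)" and c\<phi>': "continuous_on UNIV (\<phi>' n)"
    and Cc: "(\<lambda>x. of_real (\<phi> n x)) \<in> Cc 1 L" for n x
    using truncation_in_Cc[OF s s' pos bdry, where c = "inverse (real (Suc n))"]
    unfolding \<phi>_def \<phi>'_def m_def by auto
  have cs: "continuous_on UNIV s" and c\<phi>: "continuous_on UNIV (\<phi> n)" for n
    using s D by (auto intro!: continuous_at_imp_continuous_on DERIV_isCont)
  let ?c = "\<lambda>f x. complex_of_real (f x)"
  have "(sob_norm 1 L (restrict_l2 L (?c s) - abs_l2 (?c (\<phi> n))))\<^sup>2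
      = (\<integral>x. indicator {0<..<L} x * (s x - \<phi> n x)\<^sup>2 \<partial>lborel)
        + (\<integral>x. indicator {0<..<L} x * (s' x - \<phi>' n x)\<^sup>2 \<partial>lborel)" for n
  proof -
    have "restrict_l2 L (?c s) - abs_l2 (?c (\<phi> n)) = restrict_l2 L (?c (\<lambda>x. s x - \<phi> n x))"
      unfolding Cc_abs_l2_eq_restrict[OF Cc] using cs c\<phi>
      by (subst restrict_l2_diff) (auto intro!: continuous_on_of_real)
    moreover have "wderiv L (restrict_l2 L (?c (\<lambda>x. s x - \<phi> n x))) = restrict_l2 L (?c (\<lambda>x. s' x - \<phi>' n x))"
      using \<open>L > 0\<close> s' c\<phi>' s D
      by (intro wderiv_restrict has_vector_derivative_of_real DERIV_diff continuous_on_of_real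
            continuous_on_diff)
    moreover have "(norm (restrict_l2 L (?c f)))\<^sup>2 = (\<integral>x. indicator {0<..<L} x * (f x)\<^sup>2 \<partial>lborel)"
      if "continuous_on UNIV f" for f
      using that by (subst norm_restrict_l2) (auto intro!: continuous_on_of_real)
    ultimately show ?thesis
      using cs c\<phi> s' c\<phi>'
      by (simp add: sob_norm_def norm_l2_eq_norm continuous_on_diff sum_nonneg del: of_real_diff)
  qed
  moreover have "(\<lambda>n. \<integral>x. indicator {0<..<L} x * (s x - \<phi> n x)\<^sup>2 \<partial>lborel) \<longlonglongrightarrow> 0"
    "(\<lambda>n. \<integral>x. indicator {0<..<L} x * (s' x - \<phi>' n x)\<^sup>2 \<partial>lborel) \<longlonglongrightarrow> 0"
  proof -
    \<comment> \<open>An error bounded by \<open>\<bar>f x\<bar>\<close> has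
      \<open>(f x)\<^sup>2\<close> on the closed interval as integrable majorant. It is applied to
      \<open>s\<close> and to \<open>s'\<close>.\<close>
    have dom: "(\<lambda>n. \<integral>x. indicator {0<..<L} x * (f x - g n x)\<^sup>2 \<partial>lborel) \<longlonglongrightarrow> 0"
      if f: "continuous_on UNIV f" and g: "\<And>n. continuous_on UNIV (g n)"
        and lim: "\<And>x. x \<in> {0<..<L} \<Longrightarrow> (\<lambda>n. g n x) \<longlonglongrightarrow> f x"
        and bound: "\<And>n x. x \<in> {0<..<L} \<Longrightarrow> \<bar>f x - g n x\<bar> \<le> \<bar>f x\<bar>"
      for f :: "real \<Rightarrow> real" and g :: "nat \<Rightarrow> real \<Rightarrow> real"
    proof -
      have [measurable]: "f \<in> borel_measurable borel" "g n \<in> borel_measurable borel" for n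
        using f g by (auto intro: borel_measurable_continuous_onI)
      have "(\<lambda>n. \<integral>x. indicator {0<..<L} x * (f x - g n x)\<^sup>2 \<partial>lborel)
          \<longlonglongrightarrow> (\<integral>x. 0 \<partial>(lborel :: real measure))"
      proof (rule integral_dominated_convergence)
        show "integrable lborel (\<lambda>x. indicator {0..L} x *\<^sub>R (f x)\<^sup>2)"
          using f by (intro borel_integrable_compact compact_Icc continuous_intros)
            (auto intro: continuous_on_subset)
        show "AE x in lborel. (\<lambda>n. indicator {0<..<L} x * (f x - g n x)\<^sup>2) \<longlonglongrightarrow> 0"
        proof (intro AE_I2)
          fix x
          show "(\<lambda>n. indicator {0<..<L} x * (f x - g n x)\<^sup>2) \<longlonglongrightarrow> 0"
          proof (cases "x \<in> {0<..<L}")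
            case True
            have "(\<lambda>n. (f x - g n x)\<^sup>2) \<longlonglongrightarrow> (f x - f x)\<^sup>2"
              by (intro tendsto_intros lim True)
            then show ?thesis using True by simp
          qed simp
        qed
        show "AE x in lborel. norm (indicator {0<..<L} x * (f x - g n x)\<^sup>2) \<le> indicator {0..L} x *\<^sub>R (f x)\<^sup>2" for n
          using bound by (intro AE_I2) (auto simp: indicator_def abs_le_square_iff)
      qed auto
      then show ?thesis by simp
    qed
    have m_lim: "(\<lambda>n. m n x) \<longlonglongrightarrow> s x" if "x \<in> {0<..<L}" for x
    proof -
      have "(\<lambda>n. m n x) \<longlonglongrightarrow> max 0 (s x - 0)"
        unfolding m_def by (intro tendsto_intros LIMSEQ_inverse_real_of_nat)
      then show ?thesis using pos that by (simp add: max_absorb2 less_imp_le)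
    qed
    have m_bound: "0 \<le> m n x" "m n x \<le> s x" if "x \<in> {0<..<L}" for n x
      using pos[of x] that by (auto simp: m_def)
    show "(\<lambda>n. \<integral>x. indicator {0<..<L} x * (s x - \<phi> n x)\<^sup>2 \<partial>lborel) \<longlonglongrightarrow> 0"
    proof (rule dom[OF cs c\<phi>])
      fix x assume x: "x \<in> {0<..<L}"
      then have sx: "s x > 0" using pos by simp
      have "(\<lambda>n. (m n x)\<^sup>2 / s x) \<longlonglongrightarrow> (s x)\<^sup>2 / s x"
        using sx by (intro tendsto_intros m_lim x) simp
      then show "(\<lambda>n. \<phi> n x) \<longlonglongrightarrow> s x" using x sx by (simp add: \<phi>_def power2_eq_square)
      fix n
      have "(m n x)\<^sup>2 \<le> (s x)\<^sup>2" using m_bound[OF x] by (intro power_mono)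
      then have "(m n x)\<^sup>2 / s x \<le> s x" using sx by (simp add: divide_le_eq power2_eq_square)
      moreover have "0 \<le> (m n x)\<^sup>2 / s x" using sx by simp
      ultimately show "\<bar>s x - \<phi> n x\<bar> \<le> \<bar>s x\<bar>" using x by (simp add: \<phi>_def)
    qed
    show "(\<lambda>n. \<integral>x. indicator {0<..<L} x * (s' x - \<phi>' n x)\<^sup>2 \<partial>lborel) \<longlonglongrightarrow> 0"
    proof (rule dom[OF s' c\<phi>'])
      fix x assume x: "x \<in> {0<..<L}"
      then have sx: "s x > 0" using pos by simp
      have "(\<lambda>n. s' x * (1 - (1 - m n x / s x)\<^sup>2)) \<longlonglongrightarrow> s' x * (1 - (1 - s x / s x)\<^sup>2)"
        using sx by (intro tendsto_intros m_lim x) simp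
      then show "(\<lambda>n. \<phi>' n x) \<longlonglongrightarrow> s' x" using x sx by (simp add: \<phi>'_def)
      fix n
      have "0 \<le> 1 - m n x / s x" "1 - m n x / s x \<le> 1" using m_bound[OF x] sx by simp_all
      then have "(1 - m n x / s x)\<^sup>2 \<le> 1" by (rule power_le_one)
      then have "\<bar>s' x\<bar> * (1 - m n x / s x)\<^sup>2 \<le> \<bar>s' x\<bar> * 1" by (intro mult_left_mono) auto
      moreover have "s' x - \<phi>' n x = s' x * (1 - m n x / s x)\<^sup>2"
        using x by (simp add: \<phi>'_def right_diff_distrib)
      ultimately show "\<bar>s' x - \<phi>' n x\<bar> \<le> \<bar>s' x\<bar>" by (simp add: abs_mult)
    qed
  qed
  ultimately have "(\<lambda>n. (sob_norm 1 L (restrict_l2 L (?c s) - abs_l2 (?c (\<phi> n))))\<^sup>2) \<longlonglongrightarrow> 0"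
    by (simp add: tendsto_add_zero)
  then have "(\<lambda>n. sqrt ((sob_norm 1 L (restrict_l2 L (?c s) - abs_l2 (?c (\<phi> n))))\<^sup>2)) \<longlonglongrightarrow> sqrt 0"
    by (intro tendsto_intros)
  moreover have "sob_norm 1 L f \<ge> 0" for f by (simp add: sob_norm_def sum_nonneg)
  ultimately have lim: "(\<lambda>n. sob_norm 1 L (restrict_l2 L (?c s) - abs_l2 (?c (\<phi> n)))) \<longlonglongrightarrow> 0"
    by simp
  fix \<epsilon> :: real assume "\<epsilon> > 0"
  from order_tendstoD(2)[OF lim this]
  obtain n where "sob_norm 1 L (restrict_l2 L (?c s) - abs_l2 (?c (\<phi> n))) < \<epsilon>"
    by (auto simp: eventually_sequentially)
  then show "\<exists>\<psi>\<in>Cc 1 L. sob_norm 1 L (restrict_l2 L (?c s) - abs_l2 \<psi>) < \<epsilon>"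
    using Cc by blast
qed

section \<open>Eigenvectors of contraction semigroups\<close>

lemma tendsto_exp_difference_quotient:
  fixes \<mu> :: complex
  shows "((\<lambda>h. (exp (of_real h * \<mu>) - 1) / of_real h) \<longlongrightarrow> \<mu>) (at_right 0)"
proof -
  have "((\<lambda>z. exp (z * \<mu>)) has_field_derivative \<mu>) (at 0)"
    by (auto intro!: derivative_eq_intros)
  then have "((\<lambda>z. (exp (z * \<mu>) - 1) / z) \<longlongrightarrow> \<mu>) (at 0)"
    by (simp add: DERIV_def)
  moreover have "filterlim (of_real :: real \<Rightarrow> complex) (at 0) (at_right 0)"
    unfolding filterlim_at
    by (auto intro!: tendsto_eq_intros simp: eventually_at_filter)
  ultimately show ?thesis by (rule filterlim_compose)
qed

text \<open>The state space is a mere subset \<open>H\<close> of a type, and \<open>N\<close> is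
  assumed to be no more than a seminorm on it. Hence the conclusion is a vanishing \<open>N\<close>
  and not an equation between vectors.\<close>

lemma semigroup_eigenvector:
  fixes sc :: "complex \<Rightarrow> 'a::real_vector \<Rightarrow> 'a"
  assumes "module sc" and scaleR: "\<And>r U. r *\<^sub>R U = sc (of_real r) U"
    and H_add: "\<And>U V. U \<in> H \<Longrightarrow> V \<in> H \<Longrightarrow> U + V \<in> H"
    and H_scale: "\<And>c U. U \<in> H \<Longrightarrow> sc c U \<in> H"
    and N_nonneg: "\<And>U. 0 \<le> N U"
    and N_add: "\<And>U V. U \<in> H \<Longrightarrow> V \<in> H \<Longrightarrow> N (U + V) \<le> N U + N V"
    and N_scale: "\<And>c U. U \<in> H \<Longrightarrow> N (sc c U) = cmod c * N U"
    and sg: "C0_contraction_semigroup sc H N T"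
    and gen: "(U, sc \<mu> U) \<in> generator H N T" and "Re \<mu> \<le> 0" and "t > 0"
  shows "N (T t U - sc (exp (of_real t * \<mu>)) U) = 0"
proof -
  interpret module sc by fact
  have U: "U \<in> H" and lim: "((\<lambda>h. N ((1 / h) *\<^sub>R (T h U - U) - sc \<mu> U)) \<longlongrightarrow> 0) (at_right 0)"
    using gen by (auto simp: generator_def)
  have T_in: "T s V \<in> H" and T_scale: "T s (sc c V) = sc c (T s V)" and T_contr: "N (T s V) \<le> N V"
    and T0: "T 0 V = V" if "s \<ge> 0" "V \<in> H" for s c V
    using sg that by (auto simp: C0_contraction_semigroup_def)
  have T_add: "T s (V + W) = T s V + T s W" if "s \<ge> 0" "V \<in> H" "W \<in> H" for s V W
    using sg that by (auto simp: C0_contraction_semigroup_def)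
  have T_plus: "T (s + r) V = T s (T r V)" if "s \<ge> 0" "r \<ge> 0" "V \<in> H" for s r V
    using sg that by (auto simp: C0_contraction_semigroup_def)
  have diff_eq: "V - W = V + sc (-1) W" for V W by simp
  have H_diff: "V - W \<in> H" if "V \<in> H" "W \<in> H" for V W
    unfolding diff_eq using that by (intro H_add H_scale)
  define e where "e h = exp (of_real h * \<mu>)" for h :: real
  define D where "D h = T h U - sc (e h) U" for h
  have D_in: "D h \<in> H" if "h \<ge> 0" for h
    using U that by (auto simp: D_def intro!: H_diff H_scale T_in)
  have small: "((\<lambda>h. N (D h) / h) \<longlongrightarrow> 0) (at_right 0)"
  proof (rule tendsto_sandwich)
    show "\<forall>\<^sub>F h in at_right 0. 0 \<le> N (D h) / h"
      using N_nonneg by (auto simp: eventually_at_filter)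
    show "\<forall>\<^sub>F h in at_right 0. N (D h) / h
        \<le> N ((1 / h) *\<^sub>R (T h U - U) - sc \<mu> U) + cmod (\<mu> - (e h - 1) / of_real h) * N U"
      unfolding eventually_at_filter
    proof (intro always_eventually allI impI)
      fix h :: real assume "h \<noteq> 0" "h \<in> {0<..}"
      then have h: "h > 0" by simp
      let ?R = "(1 / h) *\<^sub>R (T h U - U) - sc \<mu> U"
      \<comment> \<open>Per unit of time the error splits into the defect of the generator at
        \<open>U\<close> and the defect of the scalar difference quotient of the
        exponential.\<close>
      have "sc (of_real (1 / h)) (D h) = ?R + sc (\<mu> - (e h - 1) / of_real h) U"
        unfolding scaleR D_def by (simp add: algebra_simps diff_divide_distrib)
      moreover have "?R \<in> H"
        unfolding scaleR using U h by (intro H_diff H_scale T_in) auto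
      ultimately have "N (sc (of_real (1 / h)) (D h))
          \<le> N ?R + cmod (\<mu> - (e h - 1) / of_real h) * N U"
        using N_add[of ?R "sc (\<mu> - (e h - 1) / of_real h) U"] U by (simp add: H_scale N_scale)
      then show "N (D h) / h \<le> N ?R + cmod (\<mu> - (e h - 1) / of_real h) * N U"
        using h D_in[of h] by (simp add: N_scale norm_divide)
    qed
    have "((\<lambda>h. cmod (\<mu> - (e h - 1) / of_real h) * N U) \<longlongrightarrow> cmod (\<mu> - \<mu>) * N U) (at_right 0)"
      unfolding e_def by (intro tendsto_intros tendsto_exp_difference_quotient)
    from tendsto_add[OF lim this]
    show "((\<lambda>h. N ((1 / h) *\<^sub>R (T h U - U) - sc \<mu> U) + cmod (\<mu> - (e h - 1) / of_real h) * N U)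
        \<longlongrightarrow> 0) (at_right 0)" by simp
  qed simp
  have telescope: "N (D (real n * h)) \<le> real n * N (D h)" if "h \<ge> 0" for n h
  proof (induction n)
    case 0
    have "D 0 = sc 0 U" using T0[of 0 U] U by (simp add: D_def e_def)
    then have "N (D 0) = 0" using N_scale[OF U, of 0] by simp
    then show ?case by simp
  next
    case (Suc n)
    have nh: "real n * h \<ge> 0" using that by simp
    have "e (real (Suc n) * h) = e h * e (real n * h)"
      by (simp add: e_def exp_add[symmetric] algebra_simps)
    moreover have "T (real (Suc n) * h) U = T (real n * h) (T h U)"
      using T_plus[OF nh that U] by (simp add: algebra_simps)
    moreover have "T (real n * h) (D h) = T (real n * h) (T h U) + sc (- e h) (T (real n * h) U)"
    proof -
      have "D h = T h U + sc (- e h) U" by (simp add: D_def)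
      then show ?thesis using T_add T_scale nh that U T_in H_scale by presburger
    qed
    \<comment> \<open>The new error is the one-step error carried along by the semigroup plus the
      old error times \<open>e h\<close>. Contractivity and \<open>Re \<mu> \<le> 0\<close> ensure
      that neither is amplified, so errors add up at most linearly.\<close>
    ultimately have "D (real (Suc n) * h) = T (real n * h) (D h) + sc (e h) (D (real n * h))"
      by (simp only: D_def) (simp add: algebra_simps)
    then have "N (D (real (Suc n) * h)) \<le> N (T (real n * h) (D h)) + cmod (e h) * N (D (real n * h))"
      using N_add[of "T (real n * h) (D h)" "sc (e h) (D (real n * h))"] nh that
      by (simp add: T_in D_in H_scale N_scale)
    moreover have "N (T (real n * h) (D h)) \<le> N (D h)"
      using T_contr nh D_in that by blast
    moreover have "cmod (e h) \<le> 1"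
      using that \<open>Re \<mu> \<le> 0\<close> by (simp add: e_def mult_nonneg_nonpos)
    then have "cmod (e h) * N (D (real n * h)) \<le> 1 * (real n * N (D h))"
      using Suc.IH N_nonneg by (intro mult_mono) auto
    ultimately show ?case by (simp add: algebra_simps)
  qed
  have "(\<lambda>n. t * (N (D (t / real (Suc n))) / (t / real (Suc n)))) \<longlonglongrightarrow> t * 0"
  proof (intro tendsto_mult_left filterlim_compose[OF small])
    have "(\<lambda>n. t * inverse (real (Suc n))) \<longlonglongrightarrow> t * 0"
      by (intro tendsto_mult_left LIMSEQ_inverse_real_of_nat)
    then show "filterlim (\<lambda>n. t / real (Suc n)) (at_right 0) sequentially"
      unfolding filterlim_at using \<open>t > 0\<close>
      by (auto simp: divide_inverse intro!: always_eventually)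
  qed
  \<comment> \<open>The left-hand side does not depend on \<open>n\<close>, while the bound tends to
    0. Dividing \<open>t\<close> into \<open>Suc n\<close> steps avoids a division by zero.\<close>
  moreover have "N (D t) \<le> t * (N (D (t / real (Suc n))) / (t / real (Suc n)))" for n
  proof -
    have "real (Suc n) * (t / real (Suc n)) = t" by simp
    then have "N (D t) \<le> real (Suc n) * N (D (t / real (Suc n)))"
      using telescope[of "t / real (Suc n)" "Suc n"] \<open>t > 0\<close> by simp
    moreover have "t * (x / (t / real (Suc n))) = real (Suc n) * x" for x
      using \<open>t > 0\<close> by (simp add: field_simps)
    ultimately show ?thesis by simp
  qed
  ultimately have "N (D t) \<le> t * 0"
    by (intro LIMSEQ_le_const) auto
  then show ?thesis
    using N_nonneg[of "D t"] by (simp add: D_def e_def)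
qed

section \<open>The energy space\<close>

lemma state_cases [case_names fields]:
  obtains u1 v1 y1 z1 w p u3 v3 y3 z3 where "(U :: state) = (u1, v1, y1, z1, w, p, u3, v3, y3, z3)"
proof -
  obtain u1 v1 y1 z1 w p r where "U = (u1, v1, y1, z1, w, p, r)" by (cases U)
  moreover obtain u3 v3 y3 z3 where "r = (u3, v3, y3, z3)" by (cases r)
  ultimately show ?thesis using that by blast
qed

interpretation scaleC_state: module scaleC_state
proof
  fix a b :: complex and U V :: state
  show "scaleC_state a (U + V) = scaleC_state a U + scaleC_state a V"
    by (cases U rule: state_cases; cases V rule: state_cases)
       (simp add: scaleC_state_def scaleC_l2.scale_right_distrib)
  show "scaleC_state (a + b) U = scaleC_state a U + scaleC_state b U"
    by (cases U rule: state_cases) (simp add: scaleC_state_def scaleC_l2.scale_left_distrib)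
  show "scaleC_state a (scaleC_state b U) = scaleC_state (a * b) U"
    by (cases U rule: state_cases) (simp add: scaleC_state_def)
  show "scaleC_state 1 U = U"
    by (cases U rule: state_cases) (simp add: scaleC_state_def)
qed

lemma scaleR_state_eq_scaleC: "r *\<^sub>R (U :: state) = scaleC_state (of_real r) U"
  by (cases U rule: state_cases) (simp add: scaleC_state_def scaleR_l2_eq_scaleC)

lemma scaleR_scaleC_l2: "r *\<^sub>R scaleC_l2 c f = scaleC_l2 c (r *\<^sub>R f)"
  by (simp add: scaleR_l2_eq_scaleC mult.commute)

lemma energy_space_add:
  "len B > 0 \<Longrightarrow> U \<in> energy_space B \<Longrightarrow> V \<in> energy_space B \<Longrightarrow> U + V \<in> energy_space B"
  by (cases U rule: state_cases; cases V rule: state_cases)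
     (simp add: energy_space_def Let_def Sob0_add L2_add)

lemma energy_space_scaleC:
  "len B > 0 \<Longrightarrow> U \<in> energy_space B \<Longrightarrow> scaleC_state c U \<in> energy_space B"
  by (cases U rule: state_cases) (simp add: energy_space_def scaleC_state_def Let_def Sob0_scaleC L2_scaleC)

text \<open>These are the arguments to which the energy applies \<open>wderiv\<close>, with orders
  in the \<open>Suc\<close> form matched by the linearity rules. The derivative of \<open>w\<close>
  is listed because the energy differentiates it again.\<close>

lemma energy_space_Sob:
  assumes "(u1, v1, y1, z1, w, p, u3, v3, y3, z3) \<in> energy_space B"
  shows "u1 \<in> Sob (Suc 0) (len B)" "y1 \<in> Sob (Suc 0) (len B)" "w \<in> Sob (Suc (Suc 0)) (len B)"
    "wderiv (len B) w \<in> Sob (Suc 0) (len B)" "u3 \<in> Sob (Suc 0) (len B)" "y3 \<in> Sob (Suc 0) (len B)"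
proof -
  show w: "w \<in> Sob (Suc (Suc 0)) (len B)"
    using assms by (simp add: energy_space_def Let_def numeral_2_eq_2 Sob0_imp_Sob del: Sob.simps)
  then show "wderiv (len B) w \<in> Sob (Suc 0) (len B)" by (rule SobD)
qed (use assms in \<open>simp_all add: energy_space_def Let_def Sob0_imp_Sob del: Sob.simps\<close>)

lemma tau_add:
  assumes "w \<in> Sob (Suc k) (len B)" "w' \<in> Sob (Suc k) (len B)"
  shows "tau B (u1 + u1') (y1 + y1') (w + w') (u3 + u3') (y3 + y3')
    = tau B u1 y1 w u3 y3 + tau B u1' y1' w' u3' y3'"
  unfolding tau_def wderiv_add[OF assms] by (simp add: algebra_simps)

lemma tau_scaleC:
  assumes "w \<in> Sob (Suc k) (len B)"
  shows "tau B (scaleC_l2 c u1) (scaleC_l2 c y1) (scaleC_l2 c w) (scaleC_l2 c u3) (scaleC_l2 c y3)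
    = scaleC_l2 c (tau B u1 y1 w u3 y3)"
  unfolding tau_def wderiv_scaleC[OF assms]
  by (simp add: scaleR_scaleC_l2 scaleC_l2.scale_right_distrib scaleC_l2.scale_right_diff_distrib)

lemma norm_Pair_power2: "(norm (a, b))\<^sup>2 = (norm a)\<^sup>2 + (norm b)\<^sup>2"
  by (simp add: norm_Pair)

lemma energy_norm_scaleC:
  assumes "U \<in> energy_space B"
  shows "energy_norm B (scaleC_state c U) = cmod c * energy_norm B U"
proof (cases U rule: state_cases)
  case (fields u1 v1 y1 z1 w p u3 v3 y3 z3)
  note S = energy_space_Sob[OF assms[unfolded fields]]
  show ?thesis
    unfolding fields energy_norm_def scaleC_state_def Let_def prod.case norm_l2_eq_norm
      S[THEN wderiv_scaleC] tau_scaleC[OF S(3)] scaleC_l2.scale_right_distrib[symmetric]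
      norm_scaleC_l2 power_mult_distrib mult.left_commute[of _ "(cmod c)\<^sup>2"]
      distrib_left[symmetric] real_sqrt_mult real_sqrt_abs abs_norm_cancel ..
qed

text \<open>The thirteen terms of the energy, weighted by square roots of their coefficients. The
  energy norm becomes the Euclidean norm of a tuple that depends additively on the state.\<close>

definition energy_components :: "beam \<Rightarrow> state \<Rightarrow>
    l2 \<times> l2 \<times> l2 \<times> l2 \<times> l2 \<times> l2 \<times> l2 \<times> l2 \<times> l2 \<times> l2 \<times> l2 \<times> l2 \<times> l2" where
  "energy_components B = (\<lambda>(u1, v1, y1, z1, w, p, u3, v3, y3, z3).
     let D = wderiv (len B) in
     (sqrt (E1 B * h1 B) *\<^sub>R D u1, sqrt (rho1 B * h1 B) *\<^sub>R v1,
      sqrt (E3 B * h3 B) *\<^sub>R D u3, sqrt (rho3 B * h3 B) *\<^sub>R v3,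
      sqrt (EI B) *\<^sub>R D (D w), sqrt (rho_h B) *\<^sub>R p,
      sqrt (E1 B * I1 B) *\<^sub>R D y1, sqrt (rho1 B * I1 B) *\<^sub>R z1,
      sqrt (E3 B * I3 B) *\<^sub>R D y3, sqrt (rho3 B * I3 B) *\<^sub>R z3,
      sqrt (G1 B * h1 B) *\<^sub>R (D w + y1), tau B u1 y1 w u3 y3, sqrt (G3 B * h3 B) *\<^sub>R (D w + y3)))"

lemma energy_components_add:
  assumes "U \<in> energy_space B" "V \<in> energy_space B"
  shows "energy_components B (U + V) = energy_components B U + energy_components B V"
proof (cases U rule: state_cases)
  case U: (fields u1 v1 y1 z1 w p u3 v3 y3 z3)
  show ?thesis
  proof (cases V rule: state_cases)
    case V: (fields u1' v1' y1' z1' w' p' u3' v3' y3' z3')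
    note S = energy_space_Sob[OF assms(1)[unfolded U]] energy_space_Sob[OF assms(2)[unfolded V]]
    show ?thesis
      unfolding U V energy_components_def Let_def prod.case add_Pair
        wderiv_add[OF S(1,7)] wderiv_add[OF S(2,8)] wderiv_add[OF S(3,9)] wderiv_add[OF S(4,10)]
        wderiv_add[OF S(5,11)] wderiv_add[OF S(6,12)] tau_add[OF S(3,9)]
      by (simp add: scaleR_add_right)
  qed
qed

locale beam_params =
  fixes B :: beam
  assumes len_pos: "len B > 0"
    and rho_pos: "rho1 B > 0" "rho2 B > 0" "rho3 B > 0"
    and h_pos: "h1 B > 0" "h2 B > 0" "h3 B > 0"
    and elastic_pos: "E1 B > 0" "E3 B > 0" "I1 B > 0" "I3 B > 0" "G1 B > 0" "G3 B > 0"
begin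

lemma energy_norm_eq: "energy_norm B U = norm (energy_components B U)"
proof (cases U rule: state_cases)
  case (fields u1 v1 y1 z1 w p u3 v3 y3 z3)
  have "rho_h B \<ge> 0" "EI B \<ge> 0"
    using rho_pos h_pos elastic_pos by (simp_all add: rho_h_def EI_def add_nonneg_nonneg)
  then have "energy_norm B U = sqrt ((norm (energy_components B U))\<^sup>2)"
    using rho_pos h_pos elastic_pos unfolding fields
    by (simp add: energy_components_def energy_norm_def Let_def norm_Pair_power2 norm_l2_eq_norm
          power_mult_distrib del: real_sqrt_abs)
  then show ?thesis by simp
qed

lemma energy_norm_triangle:
  "U \<in> energy_space B \<Longrightarrow> V \<in> energy_space B \<Longrightarrow> energy_norm B (U + V) \<le> energy_norm B U + energy_norm B V"
  by (simp add: energy_norm_eq energy_components_add norm_triangle_ineq)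

end

section \<open>The undamped eigenvector\<close>

text \<open>The first Dirichlet mode: among the modes \<open>sin (n * pi * x / L)\<close> with
  \<open>n \<ge> 1\<close> it is the one without interior zeros, as the truncation argument for
  \<open>Sob0\<close> requires.\<close>

definition sine_l2 :: "real \<Rightarrow> l2" where
  "sine_l2 L = restrict_l2 L (\<lambda>x. of_real (sin (pi * x / L)))"

lemma sine_l2_in_Sob0_1:
  assumes "L > 0"
  shows "sine_l2 L \<in> Sob0 1 L"
  unfolding sine_l2_def
proof (rule restrict_in_Sob0_1[OF assms])
  show "((\<lambda>x. sin (pi * x / L)) has_real_derivative cos (pi * x / L) * (pi / L)) (at x)" for x
    using assms by (auto intro!: derivative_eq_intros)
  show "continuous_on UNIV (\<lambda>x. cos (pi * x / L) * (pi / L))"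
    using assms by (intro continuous_intros) auto
  show "0 < sin (pi * x / L)" if "0 < x" "x < L" for x
    using that assms by (intro sin_gt_zero) (auto simp: field_simps)
qed (use assms in auto)

lemma sine_l2_weak_derivatives:
  assumes "L > 0"
  shows "sine_l2 L \<in> Sob 2 L" and "wderiv L (wderiv L (sine_l2 L)) = (- (pi / L)\<^sup>2) *\<^sub>R sine_l2 L"
proof -
  let ?s = "\<lambda>x. complex_of_real (sin (pi * x / L))"
  let ?s' = "\<lambda>x. complex_of_real (cos (pi * x / L) * (pi / L))"
  let ?s'' = "\<lambda>x. complex_of_real (- (pi / L)\<^sup>2) * ?s x"
  have D1: "(?s has_vector_derivative ?s' x) (at x)" for x
    by (intro has_vector_derivative_of_real) (use assms in \<open>auto intro!: derivative_eq_intros\<close>)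
  have D2: "(?s' has_vector_derivative ?s'' x) (at x)" for x
  proof -
    have "((\<lambda>x. cos (pi * x / L) * (pi / L)) has_real_derivative (- (pi / L)\<^sup>2) * sin (pi * x / L)) (at x)"
      using assms by (auto intro!: derivative_eq_intros simp: power2_eq_square)
    then show ?thesis
      unfolding of_real_mult[symmetric] by (rule has_vector_derivative_of_real)
  qed
  have cont: "continuous_on UNIV ?s" "continuous_on UNIV ?s''"
    using assms by (auto intro!: continuous_intros)
  have cont': "continuous_on UNIV ?s'"
    using D2 by (rule has_vector_derivative_imp_continuous_on)
  have w1: "wderiv L (sine_l2 L) = restrict_l2 L ?s'"
    unfolding sine_l2_def using assms D1 cont' by (rule wderiv_restrict)
  have w2: "wderiv L (restrict_l2 L ?s') = restrict_l2 L ?s''"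
    using assms D2 cont(2) by (rule wderiv_restrict)
  show "wderiv L (wderiv L (sine_l2 L)) = (- (pi / L)\<^sup>2) *\<^sub>R sine_l2 L"
    unfolding w1 w2 scaleR_l2_eq_scaleC unfolding sine_l2_def
    by (rule restrict_l2_scaleC[OF cont(1), symmetric])
  have "Ck 2 ?s"
    unfolding numeral_2_eq_2 Ck.simps
    by (intro exI[of _ ?s'] exI[of _ ?s''] conjI allI D1 D2 cont(2))
  then show "sine_l2 L \<in> Sob 2 L"
    unfolding sine_l2_def by (rule restrict_l2_in_Sob[OF assms])
qed

lemma sine_l2_nonzero:
  assumes "L > 0"
  shows "sine_l2 L \<noteq> 0"
proof
  let ?s = "\<lambda>x. complex_of_real (sin (pi * x / L))"
  have cont: "continuous_on UNIV ?s"
    using assms by (auto intro!: continuous_intros)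
  assume "sine_l2 L = 0"
  then have "AE x in lborel. (if x \<in> {0<..<L} then ?s x else 0) = 0"
    unfolding sine_l2_def restrict_l2_def zero_l2_eq_abs
      abs_l2_eq_iff[OF square_integrable_restrict[OF cont] square_integrable_0] .
  then have "AE x in lborel. x \<notin> {0<..<L}"
  proof eventually_elim
    case (elim x)
    have "sin (pi * x / L) > 0" if "x \<in> {0<..<L}"
      using that assms by (intro sin_gt_zero) (auto simp: field_simps)
    then show ?case using elim by (auto split: if_splits)
  qed
  then have "{0<..<L} \<in> null_sets lborel"
    by (subst AE_iff_null_sets) auto
  then show False
    using assms by (auto simp: null_sets_def)
qed

text \<open>The velocity \<open>\<i> * l * u\<close> is forced by the displacement rows of the
  eigenvalue equation with eigenvalue \<open>\<i> * l\<close>.\<close>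

definition sine_state :: "real \<Rightarrow> real \<Rightarrow> state" where
  "sine_state l L = (let u = sine_l2 L; v = scaleC_l2 (\<i> * of_real l) u in (u, v, 0, 0, 0, 0, u, v, 0, 0))"

lemma sine_state_in_op_domain:
  assumes "len B > 0"
  shows "sine_state l (len B) \<in> op_domain B"
  using sine_l2_in_Sob0_1[OF assms] sine_l2_weak_derivatives(1)[OF assms] assms
    Sob_0[of 2 "len B"] Sob_0[of 4 "len B"]
  by (simp add: sine_state_def op_domain_def Let_def Sob0_0 Sob0_scaleC del: Sob.simps)

lemma sine_state_in_energy_space:
  assumes "len B > 0"
  shows "sine_state l (len B) \<in> energy_space B"
proof -
  have "sine_l2 (len B) \<in> L2 (len B)"
    unfolding sine_l2_def using assms by (intro restrict_l2_in_L2 continuous_intros) auto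
  then show ?thesis
    using sine_l2_in_Sob0_1[OF assms]
    by (simp add: sine_state_def energy_space_def Let_def Sob0_0 L2_0 L2_scaleC)
qed

text \<open>Since \<open>u\<^sup>1 = u\<^sup>3\<close> and all other displacements vanish, \<open>\<tau> = 0\<close>; what remains are two wave
  equations with the common speed \<open>E\<^sub>1/\<rho>\<^sub>1 = E\<^sub>3/\<rho>\<^sub>3\<close>.\<close>

lemma (in beam_params) beam_op_sine_state:
  assumes undamped: "damp_a B = 0" "damp_d B = 0" and speeds: "E1 B / rho1 B = E3 B / rho3 B"
    and l: "l\<^sup>2 = E1 B / rho1 B * (pi / len B)\<^sup>2"
  shows "beam_op B (sine_state l (len B)) = scaleC_state (\<i> * of_real l) (sine_state l (len B))"
proof -
  let ?u = "sine_l2 (len B)"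
  \<comment> \<open>The velocity rows of the eigenvalue equation apply the factor
    \<open>\<i> * l\<close> to a velocity that already contains it.\<close>
  have square: "scaleC_l2 ((\<i> * of_real l) * (\<i> * of_real l)) ?u = - (l\<^sup>2 *\<^sub>R ?u)"
  proof -
    have "(\<i> * of_real l) * (\<i> * of_real l) = - complex_of_real (l\<^sup>2)"
      by (simp add: power2_eq_square complex_eq_iff)
    then show ?thesis by (simp add: scaleR_l2_eq_scaleC del: of_real_power)
  qed
  have tau: "tau B ?u 0 0 ?u 0 = 0" by (simp add: tau_def)
  have "(1 / (rho1 B * h1 B)) *\<^sub>R ((E1 B * h1 B) *\<^sub>R wderiv (len B) (wderiv (len B) ?u)) = - (l\<^sup>2 *\<^sub>R ?u)"
    "(1 / (rho3 B * h3 B)) *\<^sub>R ((E3 B * h3 B) *\<^sub>R wderiv (len B) (wderiv (len B) ?u)) = - (l\<^sup>2 *\<^sub>R ?u)"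
    using rho_pos h_pos l l[unfolded speeds] by (simp_all add: sine_l2_weak_derivatives len_pos)
  then show ?thesis
    using undamped tau square
    by (simp add: beam_op_def sine_state_def scaleC_state_def Let_def)
qed

text \<open>The kinetic term of \<open>v1\<close> already excludes zero energy, since
  \<open>l\<close> and the sine are nonzero.\<close>

lemma (in beam_params) energy_norm_sine_state_pos:
  assumes "l \<noteq> 0"
  shows "energy_norm B (sine_state l (len B)) > 0"
proof -
  have "energy_components B (sine_state l (len B)) \<noteq> 0"
  proof
    assume "energy_components B (sine_state l (len B)) = 0"
    then have "scaleC_l2 (\<i> * of_real l) (sine_l2 (len B)) = 0"
      using rho_pos(1) h_pos(1) by (simp add: energy_components_def sine_state_def Let_def zero_prod_def)
    then have "norm (scaleC_l2 (\<i> * of_real l) (sine_l2 (len B))) = 0" by simp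
    then show False
      using assms sine_l2_nonzero[OF len_pos] by (simp add: norm_mult)
  qed
  then show ?thesis by (simp add: energy_norm_eq)
qed

theorem theorem2p4:
  fixes B :: beam and T :: "real \<Rightarrow> state \<Rightarrow> state"
  assumes "len B > 0"
    and "rho1 B > 0" "rho2 B > 0" "rho3 B > 0"
    and "h1 B > 0" "h2 B > 0" "h3 B > 0"
    and "E1 B > 0" "E3 B > 0" "I1 B > 0" "I3 B > 0" "G1 B > 0" "G3 B > 0"
    and "damp_a B \<ge> 0" "damp_b B \<ge> 0" "damp_c B \<ge> 0" "damp_d B \<ge> 0" "damp_e B \<ge> 0"
    and semigroup: "generated_semigroup B T"
    and cases:
      "(damp_b B > 0 \<and> damp_c B > 0 \<and> damp_a B = 0 \<and> damp_d B = 0 \<and> damp_e B = 0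
          \<and> E1 B / rho1 B = E3 B / rho3 B)
     \<or> (damp_b B > 0 \<and> damp_e B > 0 \<and> damp_a B = 0 \<and> damp_c B = 0 \<and> damp_d B = 0
          \<and> G1 B \<noteq> G3 B \<and> E1 B / rho1 B = E3 B / rho3 B)
     \<or> (damp_b B > 0 \<and> damp_e B > 0 \<and> damp_a B = 0 \<and> damp_c B = 0 \<and> damp_d B = 0
          \<and> G1 B = G3 B \<and> E1 B / rho1 B = E3 B / rho3 B)"
  shows "\<exists>U0\<in>energy_space B. \<not> ((\<lambda>t. energy_norm B (T t U0)) \<longlongrightarrow> 0) at_top"
proof -
  interpret beam_params B using assms by unfold_locales
  \<comment> \<open>Common to the three alternatives, so that one eigenvector serves them
    all.\<close>
  have undamped: "damp_a B = 0" "damp_d B = 0" and speeds: "E1 B / rho1 B = E3 B / rho3 B"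
    using cases by auto
  define l where "l = sqrt (E1 B / rho1 B) * (pi / len B)"
  define U where "U = sine_state l (len B)"
  have l: "l \<noteq> 0" using len_pos elastic_pos rho_pos by (simp add: l_def)
  have "0 \<le> E1 B / rho1 B" using elastic_pos rho_pos by simp
  then have l2: "l\<^sup>2 = E1 B / rho1 B * (pi / len B)\<^sup>2"
    by (simp only: l_def power_mult_distrib real_sqrt_pow2)
  have U: "U \<in> energy_space B"
    unfolding U_def by (rule sine_state_in_energy_space[OF len_pos])
  have sg: "C0_contraction_semigroup scaleC_state (energy_space B) (energy_norm B) T"
    using semigroup by (simp add: generated_semigroup_def)
  have "(U, beam_op B U) \<in> generator (energy_space B) (energy_norm B) T"
    using semigroup sine_state_in_op_domain[OF len_pos] unfolding generated_semigroup_def U_def by blast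
  then have gen: "(U, scaleC_state (\<i> * of_real l) U) \<in> generator (energy_space B) (energy_norm B) T"
    by (simp add: U_def beam_op_sine_state[OF undamped speeds l2])
  have lower: "energy_norm B U \<le> energy_norm B (T t U)" if "t > 0" for t
  proof -
    let ?c = "exp (of_real t * (\<i> * of_real l))"
    have TU: "T t U \<in> energy_space B"
      using sg U that by (simp add: C0_contraction_semigroup_def)
    have "energy_norm B (T t U - scaleC_state ?c U) = 0"
    proof (rule semigroup_eigenvector[OF scaleC_state.module_axioms scaleR_state_eq_scaleC
          energy_space_add energy_space_scaleC _ energy_norm_triangle energy_norm_scaleC sg gen _ that])
    qed (auto simp: energy_norm_eq len_pos)
    moreover have "T t U - scaleC_state ?c U = T t U + scaleC_state (- ?c) U" by simp
    then have "T t U - scaleC_state ?c U \<in> energy_space B"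
      using TU U by (simp only: energy_space_add energy_space_scaleC len_pos)
    \<comment> \<open>Only the energy of the difference is known to vanish. Writing the rotated
      eigenvector as \<open>T t U\<close> minus that difference, the triangle inequality bounds its
      energy by that of \<open>T t U\<close>.\<close>
    ultimately have "energy_norm B (T t U + scaleC_state (-1) (T t U - scaleC_state ?c U))
        \<le> energy_norm B (T t U)"
      using energy_norm_triangle[OF TU energy_space_scaleC[OF len_pos]] energy_norm_scaleC
      by (metis add.right_neutral mult_zero_right)
    moreover have "T t U + scaleC_state (-1) (T t U - scaleC_state ?c U) = scaleC_state ?c U"
      by simp
    moreover have "energy_norm B (scaleC_state ?c U) = energy_norm B U"
      using energy_norm_scaleC[OF U] by simp
    ultimately show ?thesis by simp
  qed
  have "\<not> ((\<lambda>t. energy_norm B (T t U)) \<longlongrightarrow> 0) at_top"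
  proof
    assume "((\<lambda>t. energy_norm B (T t U)) \<longlongrightarrow> 0) at_top"
    then have "energy_norm B U \<le> 0"
      by (rule tendsto_lowerbound)
         (auto intro: lower eventually_mono[OF eventually_gt_at_top[of 0]])
    then show False
      using energy_norm_sine_state_pos[OF l] by (simp add: U_def)
  qed
  then show ?thesis using U by blast
qed

end
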